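(* Let $G$ be a Lie group over a totally disconnected local field $\mathbb{K}$ and $\alpha\colon G\to G$ a $\mathbb{K}$-analytic endomorphism. Let $\operatorname{lev}_*(\alpha)$, $\operatorname{par}^-_*(\alpha)$ and $\operatorname{con}^-_*(\alpha)$ be the $\mathbb{K}$-analytic Lie groups described in the context. Then: (a) $\operatorname{ik}(\alpha)\cap\operatorname{lev}_*(\alpha)$ is discrete (in $\operatorname{lev}_*(\alpha)$). (b) $\ker(\alpha)\cap\operatorname{par}^-_*(\alpha)$ is discrete (in $\operatorname{par}^-_*(\alpha)$). (c) $\ker(\alpha)\cap\operatorname{con}^-_*(\alpha)$ is discrete (in $\operatorname{con}^-_*(\alpha)$).
   Context: Conventions. A totally disconnected local field $\mathbb{K}$ is a non-discrete, locally compact, totally disconnected topological field; fix an absolute value $|\cdot|$ defining its topology and its extension to an algebraic closure $\overline{\mathbb{K}}$. $\mathbb{K}$-analytic manifolds and Lie groups are finite-dimensional (modelled on $\mathbb{K}^m$), in the sense of Serre's "Lie Algebras and Lie Groups"; topological groups are Hausdorff. The iterated kernel is $\operatorname{ik}(\alpha):=\bigcup_{n\in\mathbb{N}_0}\ker(\alpha^n)$. Subgroups. For $x\in G$, an $\alpha$-regressive trajectory for $x$ is a sequence $(x_{-n})_{n\in\mathbb{N}_0}$ in $G$ with $x_0=x$ and $\alpha(x_{-n})=x_{-n+1}$ for all $n\geq 1$. Define subgroups of $G$: $\operatorname{con}^-(\alpha)$ is the set of $x$ having an $\alpha$-regressive trajectory with $x_{-n}\to e$ as $n\to\infty$; $\operatorname{par}(\alpha)$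 is the set of $x$ with $\{\alpha^n(x)\colon n\in\mathbb{N}_0\}$ relatively compact in $G$; $\operatorname{par}^-(\alpha)$ is the set of $x$ having an $\alpha$-regressive trajectory with $\{x_{-n}\colon n\in\mathbb{N}_0\}$ relatively compact in $G$; $\operatorname{lev}(\alpha):=\operatorname{par}(\alpha)\cap\operatorname{par}^-(\alpha)$. Characteristic subspaces. Let $\beta\colon E\to E$ be an endomorphism of a finite-dimensional $\mathbb{K}$-vector space. Its set of characteristic values is $R(\beta):=\{|\lambda|\colon\lambda\in\overline{\mathbb{K}}\text{ an eigenvalue of }\beta\otimes\operatorname{id}_{\overline{\mathbb{K}}}\}\subseteq[0,\infty[$. There are unique $\beta$-invariant subspaces $E_\rho$ ($\rho\in R(\beta)$) with $E=\bigoplus_{\rho\in R(\beta)}E_\rho$ such that $E_\rho\otimes_{\mathbb{K}}\overline{\mathbb{K}}$ is the sum of the generalized eigenspaces for eigenvalues $\lambda$ with $|\lambda|=\rho$; put $E_\rho:=\{0\}$ if $\rho\notin R(\beta)$. Write $E_{>b}:=\bigoplus_{\rho>b}E_\rho$ and $E_{\geq b}:=\bigoplus_{\rho\geq b}E_\rho$. Local invariant manifolds. Let $E=T_eG$ with the characteristic subspaces with respect to $T_e\alpha$, and let $N\subseteq G$ be a submanifold with $e\in N$. For $\alpha$ around $e$, $N$ is called: a centre manifold if $\alpha(N)=N$ and $T_eN=E_1$; a local unstable manifold if $T_eN=E_{>b}$ for some $b\in[1,\infty[\,\setminus R(T_e\alpha)$ with $b<\rho$ for each $\rho\in R(T_e\alpha)$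 with $\rho>1$, and there is an open $e$-neighbourhood $P\subseteq N$ with $\alpha(P)\subseteq N$; a local centre-unstable manifold if $T_eN=E_{\geq1}$ and there is an open $e$-neighbourhood $P\subseteq N$ with $\alpha(P)\subseteq N$. The Lie groups. $\operatorname{lev}_*(\alpha)$, $\operatorname{par}^-_*(\alpha)$, $\operatorname{con}^-_*(\alpha)$ denote the groups $\operatorname{lev}(\alpha)$, $\operatorname{par}^-(\alpha)$, $\operatorname{con}^-(\alpha)$ endowed with the unique (existing) $\mathbb{K}$-analytic manifold structure making them a $\mathbb{K}$-analytic Lie group having an open subset (with the induced manifold structure) which is, respectively, a centre manifold, a local centre-unstable manifold, a local unstable manifold for $\alpha$ around $e$. *)

theory Defs
  imports
    "HOL-Analysis.Analysis"
    "HOL-Algebra.Algebra"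
    "HOL-Algebra.Algebraic_Closure_Type"
    "HOL-Library.Function_Algebras"
begin

section \<open>Totally disconnected local fields\<close>

class td_local_field = field + t2_space + topological_ab_group_add + topological_semigroup_mult +
  assumes tendsto_inverse_nonzero: "x \<noteq> 0 \<Longrightarrow> filterlim inverse (nhds (inverse x)) (nhds x)"
    and not_open_zero: "\<not> open {0}"
    and locally_compact: "\<exists>U C. open U \<and> compact C \<and> x \<in> U \<and> U \<subseteq> C"
    and totally_disconnected: "connected S \<Longrightarrow> \<exists>a. S \<subseteq> {a}"

definition absolute_value :: "('a::field \<Rightarrow> real) \<Rightarrow> bool" where
  "absolute_value av \<longleftrightarrow>
     (\<forall>x. 0 \<le> av x) \<and> (\<forall>x. av x = 0 \<longleftrightarrow> x = 0) \<and>
     (\<forall>x y. av (x * y) = av x * av y) \<and> (\<forall>x y. av (x + y) \<le> av x + av y)"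

definition induces_topology :: "('a::{field,topological_space} \<Rightarrow> real) \<Rightarrow> bool" where
  "induces_topology av \<longleftrightarrow>
     (\<forall>U. open U \<longleftrightarrow> (\<forall>x\<in>U. \<exists>r>0. \<forall>y. av (y - x) < r \<longrightarrow> y \<in> U))"


section \<open>Analytic maps between open subsets of coordinate spaces\<close>

text \<open>The space \<open>K^m\<close> is represented by the sequences vanishing from index \<open>m\<close> on, with the
  topology induced by the product topology; in particular \<open>K^d\<close> is literally a subset of
  \<open>K^m\<close> for \<open>d \<le> m\<close>.\<close>

definition coord_space :: "nat \<Rightarrow> (nat \<Rightarrow> 'k::zero) set" where
  "coord_space m = {x. \<forall>i\<ge>m. x i = 0}"

definition multi_indices :: "nat \<Rightarrow> (nat \<Rightarrow> nat) set" where
  "multi_indices m = {a. \<forall>i\<ge>m. a i = 0}"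

definition power_series_analytic_at ::
    "nat \<Rightarrow> ((nat \<Rightarrow> 'k) \<Rightarrow> 'k::td_local_field) \<Rightarrow> (nat \<Rightarrow> 'k) \<Rightarrow> bool" where
  "power_series_analytic_at m f x \<longleftrightarrow>
     (\<exists>c V. openin (top_of_set (coord_space m)) V \<and> (\<lambda>_. 0) \<in> V \<and>
        (\<forall>h\<in>V. ((\<lambda>a. c a * (\<Prod>i<m. h i ^ a i)) has_sum f (\<lambda>i. x i + h i)) (multi_indices m)))"

definition analytic_between ::
    "nat \<Rightarrow> nat \<Rightarrow> (nat \<Rightarrow> 'k) set \<Rightarrow> ((nat \<Rightarrow> 'k) \<Rightarrow> nat \<Rightarrow> 'k::td_local_field) \<Rightarrow> bool" where
  "analytic_between m n U f \<longleftrightarrow>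
     openin (top_of_set (coord_space m)) U \<and> f ` U \<subseteq> coord_space n \<and>
     (\<forall>x\<in>U. \<forall>i<n. power_series_analytic_at m (\<lambda>y. f y i) x)"

definition partial_deriv ::
    "((nat \<Rightarrow> 'k) \<Rightarrow> nat \<Rightarrow> 'k::td_local_field) \<Rightarrow> nat \<Rightarrow> nat \<Rightarrow> (nat \<Rightarrow> 'k) \<Rightarrow> 'k" where
  "partial_deriv f i j x = Lim (at 0) (\<lambda>t. (f (x(j := x j + t)) i - f x i) / t)"

definition differential ::
    "nat \<Rightarrow> nat \<Rightarrow> ((nat \<Rightarrow> 'k) \<Rightarrow> nat \<Rightarrow> 'k::td_local_field) \<Rightarrow> (nat \<Rightarrow> 'k) \<Rightarrow> (nat \<Rightarrow> 'k) \<Rightarrow> nat \<Rightarrow> 'k"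
  where
  "differential m n f x h = (\<lambda>i. if i < n then \<Sum>j<m. partial_deriv f i j x * h j else 0)"


section \<open>Analytic manifolds\<close>

text \<open>A chart is a domain together with a coordinate map. Coordinate maps are extensional
  (\<open>undefined\<close> off the domain), so that charts are equal iff they agree as partial maps.
  An analytic structure is given by its maximal atlas; two structures are therefore the same
  iff the corresponding records are equal.\<close>

type_synonym ('g, 'k) chart = "'g set \<times> ('g \<Rightarrow> nat \<Rightarrow> 'k)"

record ('g, 'k) analytic_structure =
  mtop :: "'g topology"
  mdim :: nat
  atlas :: "('g, 'k) chart set"

definition is_chart :: "'g topology \<Rightarrow> nat \<Rightarrow> ('g, 'k::td_local_field) chart \<Rightarrow> bool" where
  "is_chart T m c \<longleftrightarrow>
     openin T (fst c) \<and> snd c \<in> extensional (fst c) \<and>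
     openin (top_of_set (coord_space m)) (snd c ` fst c) \<and>
     homeomorphic_map (subtopology T (fst c)) (top_of_set (snd c ` fst c)) (snd c)"

definition in_charts ::
    "('g \<Rightarrow> 'h) \<Rightarrow> ('g, 'k) chart \<Rightarrow> ('h, 'k) chart \<Rightarrow> (nat \<Rightarrow> 'k) \<Rightarrow> nat \<Rightarrow> 'k" where
  "in_charts f c c' = (\<lambda>y. snd c' (f (inv_into (fst c) (snd c) y)))"

definition compatible_charts ::
    "nat \<Rightarrow> ('g, 'k::td_local_field) chart \<Rightarrow> ('g, 'k) chart \<Rightarrow> bool" where
  "compatible_charts m c c' \<longleftrightarrow>
     analytic_between m m (snd c ` (fst c \<inter> fst c')) (in_charts id c c') \<and>
     analytic_between m m (snd c' ` (fst c \<inter> fst c')) (in_charts id c' c)"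

definition complete_atlas ::
    "'g topology \<Rightarrow> nat \<Rightarrow> ('g, 'k::td_local_field) chart set \<Rightarrow> ('g, 'k) chart set" where
  "complete_atlas T m A = {c. is_chart T m c \<and> (\<forall>c'\<in>A. compatible_charts m c c')}"

definition analytic_manifold :: "('g, 'k::td_local_field) analytic_structure \<Rightarrow> bool" where
  "analytic_manifold M \<longleftrightarrow>
     (\<Union>c\<in>atlas M. fst c) = topspace (mtop M) \<and>
     complete_atlas (mtop M) (mdim M) (atlas M) = atlas M"

definition charts_at :: "('g, 'k) analytic_structure \<Rightarrow> 'g \<Rightarrow> ('g, 'k) chart set" where
  "charts_at M p = {c \<in> atlas M. p \<in> fst c}"

definition analytic_map ::
    "('g, 'k::td_local_field) analytic_structure \<Rightarrow> ('h, 'k) analytic_structure \<Rightarrow> ('g \<Rightarrow> 'h) \<Rightarrow> bool"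
  where
  "analytic_map M N f \<longleftrightarrow>
     continuous_map (mtop M) (mtop N) f \<and>
     (\<forall>c\<in>atlas M. \<forall>c'\<in>atlas N.
        analytic_between (mdim M) (mdim N) (snd c ` {x \<in> fst c. f x \<in> fst c'}) (in_charts f c c'))"

definition coord_append :: "nat \<Rightarrow> (nat \<Rightarrow> 'k) \<Rightarrow> (nat \<Rightarrow> 'k) \<Rightarrow> nat \<Rightarrow> 'k" where
  "coord_append m x y = (\<lambda>i. if i < m then x i else y (i - m))"

definition product_chart ::
    "nat \<Rightarrow> ('g, 'k) chart \<Rightarrow> ('h, 'k) chart \<Rightarrow> ('g \<times> 'h, 'k) chart" where
  "product_chart m c c' =
     (fst c \<times> fst c',
      restrict (\<lambda>(x, y). coord_append m (snd c x) (snd c' y)) (fst c \<times> fst c'))"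

definition product_manifold ::
    "('g, 'k::td_local_field) analytic_structure \<Rightarrow> ('h, 'k) analytic_structure \<Rightarrow>
     ('g \<times> 'h, 'k) analytic_structure" where
  "product_manifold M N =
     \<lparr>mtop = prod_topology (mtop M) (mtop N), mdim = mdim M + mdim N,
      atlas = complete_atlas (prod_topology (mtop M) (mtop N)) (mdim M + mdim N)
                {product_chart (mdim M) c c' | c c'. c \<in> atlas M \<and> c' \<in> atlas N}\<rparr>"


subsection \<open>Submanifolds\<close>

definition adapted_charts ::
    "('g, 'k::td_local_field) analytic_structure \<Rightarrow> nat \<Rightarrow> 'g set \<Rightarrow> ('g, 'k) chart set" where
  "adapted_charts M d N =
     {c \<in> atlas M. snd c ` (fst c \<inter> N) = snd c ` fst c \<inter> coord_space d}"

definition submanifold ::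
    "('g, 'k::td_local_field) analytic_structure \<Rightarrow> nat \<Rightarrow> 'g set \<Rightarrow> bool" where
  "submanifold M d N \<longleftrightarrow>
     d \<le> mdim M \<and> N \<subseteq> topspace (mtop M) \<and>
     (\<forall>p\<in>N. \<exists>c\<in>adapted_charts M d N. p \<in> fst c)"

text \<open>For \<open>N\<close> open in \<open>M\<close> and \<open>d = mdim M\<close> this is the induced structure on an open subset.\<close>

definition induced_structure ::
    "('g, 'k::td_local_field) analytic_structure \<Rightarrow> nat \<Rightarrow> 'g set \<Rightarrow> ('g, 'k) analytic_structure"
  where
  "induced_structure M d N =
     \<lparr>mtop = subtopology (mtop M) N, mdim = d,
      atlas = complete_atlas (subtopology (mtop M) N) d
                ((\<lambda>c. (fst c \<inter> N, restrict (snd c) (fst c \<inter> N))) ` adapted_charts M d N)\<rparr>"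


subsection \<open>Tangent spaces\<close>

text \<open>A tangent vector at \<open>p\<close> is a family of coordinate vectors, one for each chart around \<open>p\<close>,
  transforming according to the differentials of the coordinate changes. The families are
  uncurried, so that tangent spaces are spaces of scalar functions on an index set.\<close>

definition tangent_space ::
    "('g, 'k::td_local_field) analytic_structure \<Rightarrow> 'g \<Rightarrow> (('g, 'k) chart \<times> nat \<Rightarrow> 'k) set" where
  "tangent_space M p =
     {v. (\<forall>c\<in>charts_at M p. curry v c \<in> coord_space (mdim M)) \<and>
         (\<forall>c. c \<notin> charts_at M p \<longrightarrow> curry v c = (\<lambda>_. 0)) \<and>
         (\<forall>c\<in>charts_at M p. \<forall>c'\<in>charts_at M p.
            curry v c' = differential (mdim M) (mdim M) (in_charts id c c') (snd c p) (curry v c))}"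

definition tangent_map ::
    "('g, 'k::td_local_field) analytic_structure \<Rightarrow> ('h, 'k) analytic_structure \<Rightarrow> ('g \<Rightarrow> 'h) \<Rightarrow> 'g \<Rightarrow>
     (('g, 'k) chart \<times> nat \<Rightarrow> 'k) \<Rightarrow> ('h, 'k) chart \<times> nat \<Rightarrow> 'k" where
  "tangent_map M N f p v =
     (let c = (SOME c. c \<in> charts_at M p) in
      (\<lambda>(c', i). if c' \<in> charts_at N (f p)
        then differential (mdim M) (mdim N) (in_charts f c c') (snd c p) (curry v c) i
        else 0))"

text \<open>The tangent space of a submanifold as a subspace of the ambient tangent space.\<close>

definition sub_tangent_space ::
    "('g, 'k::td_local_field) analytic_structure \<Rightarrow> nat \<Rightarrow> 'g set \<Rightarrow> 'g \<Rightarrow>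
     (('g, 'k) chart \<times> nat \<Rightarrow> 'k) set" where
  "sub_tangent_space M d N p =
     tangent_map (induced_structure M d N) M id p ` tangent_space (induced_structure M d N) p"


section \<open>Characteristic subspaces\<close>

text \<open>Linear algebra takes place in finite-dimensional subspaces \<open>E\<close> of spaces of scalar functions
  on an index set \<open>I\<close>. The canonical map from \<open>E \<otimes> K'\<close> to the \<open>K'\<close>-valued functions on \<open>I\<close>
  (where \<open>K'\<close> is the algebraic closure of \<open>K\<close>) is injective, so \<open>E \<otimes> K'\<close> is represented by
  its image, the \<open>K'\<close>-span of \<open>E\<close>.\<close>

definition fscale :: "'a::field \<Rightarrow> ('i \<Rightarrow> 'a) \<Rightarrow> 'i \<Rightarrow> 'a" where
  "fscale a v = (\<lambda>i. a * v i)"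

interpretation fun_space: vector_space "fscale :: 'a::field \<Rightarrow> ('i \<Rightarrow> 'a) \<Rightarrow> 'i \<Rightarrow> 'a"
  by unfold_locales (auto simp: fscale_def fun_eq_iff algebra_simps)

definition extend_scalars :: "('i \<Rightarrow> 'k::field) set \<Rightarrow> ('i \<Rightarrow> 'k alg_closure) set" where
  "extend_scalars E = fun_space.span ((\<lambda>v. to_ac \<circ> v) ` E)"

text \<open>The map \<open>\<beta> \<otimes> id\<close>, sending \<open>\<Sum> v \<otimes> a\<^sub>v\<close> to \<open>\<Sum> \<beta> v \<otimes> a\<^sub>v\<close>.\<close>

definition extend_endo ::
    "('i \<Rightarrow> 'k::field) set \<Rightarrow> (('i \<Rightarrow> 'k) \<Rightarrow> 'i \<Rightarrow> 'k) \<Rightarrow> ('i \<Rightarrow> 'k alg_closure) \<Rightarrow> 'i \<Rightarrow> 'k alg_closure"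
  where
  "extend_endo E \<beta> w =
     (THE u. \<exists>F a. finite F \<and> F \<subseteq> E \<and>
        w = (\<Sum>v\<in>F. fscale (a v) (to_ac \<circ> v)) \<and> u = (\<Sum>v\<in>F. fscale (a v) (to_ac \<circ> \<beta> v)))"

definition generalized_eigenspace ::
    "('i \<Rightarrow> 'k::field) set \<Rightarrow> (('i \<Rightarrow> 'k) \<Rightarrow> 'i \<Rightarrow> 'k) \<Rightarrow> 'k alg_closure \<Rightarrow> ('i \<Rightarrow> 'k alg_closure) set"
  where
  "generalized_eigenspace E \<beta> \<mu> =
     {w \<in> extend_scalars E. \<exists>n. ((\<lambda>u. extend_endo E \<beta> u - fscale \<mu> u) ^^ n) w = 0}"

definition is_eigenvalue ::
    "('i \<Rightarrow> 'k::field) set \<Rightarrow> (('i \<Rightarrow> 'k) \<Rightarrow> 'i \<Rightarrow> 'k) \<Rightarrow> 'k alg_closure \<Rightarrow> bool" where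
  "is_eigenvalue E \<beta> \<mu> \<longleftrightarrow> (\<exists>w\<in>extend_scalars E. w \<noteq> 0 \<and> extend_endo E \<beta> w = fscale \<mu> w)"

text \<open>Here and below, \<open>avc\<close> is the absolute value on the algebraic closure.\<close>

definition characteristic_values ::
    "('k::field alg_closure \<Rightarrow> real) \<Rightarrow> ('i \<Rightarrow> 'k) set \<Rightarrow> (('i \<Rightarrow> 'k) \<Rightarrow> 'i \<Rightarrow> 'k) \<Rightarrow> real set" where
  "characteristic_values avc E \<beta> = {avc \<mu> | \<mu>. is_eigenvalue E \<beta> \<mu>}"

text \<open>The properties defining the (unique) family of characteristic subspaces.\<close>

definition characteristic_subspaces ::
    "('k::field alg_closure \<Rightarrow> real) \<Rightarrow> ('i \<Rightarrow> 'k) set \<Rightarrow> (('i \<Rightarrow> 'k) \<Rightarrow> 'i \<Rightarrow> 'k) \<Rightarrow>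
     (real \<Rightarrow> ('i \<Rightarrow> 'k) set) \<Rightarrow> bool" where
  "characteristic_subspaces avc E \<beta> Es \<longleftrightarrow>
     (let R = characteristic_values avc E \<beta> in
      (\<forall>\<rho>\<in>R. fun_space.subspace (Es \<rho>) \<and> Es \<rho> \<subseteq> E \<and> \<beta> ` Es \<rho> \<subseteq> Es \<rho> \<and>
         extend_scalars (Es \<rho>) = fun_space.span (\<Union>\<mu>\<in>{\<mu>. avc \<mu> = \<rho>}. generalized_eigenspace E \<beta> \<mu>)) \<and>
      (\<forall>\<rho>. \<rho> \<notin> R \<longrightarrow> Es \<rho> = {0}) \<and>
      (\<forall>v\<in>E. \<exists>!f. (\<forall>\<rho>\<in>R. f \<rho> \<in> Es \<rho>) \<and> (\<forall>\<rho>. \<rho> \<notin> R \<longrightarrow> f \<rho> = 0) \<and> v = (\<Sum>\<rho>\<in>R. f \<rho>)))"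

definition sum_of_subspaces :: "real set \<Rightarrow> (real \<Rightarrow> ('i \<Rightarrow> 'k::field) set) \<Rightarrow> ('i \<Rightarrow> 'k) set" where
  "sum_of_subspaces I Es = fun_space.span (\<Union>\<rho>\<in>I. Es \<rho>)"


section \<open>Lie groups and endomorphisms\<close>

definition lie_group :: "'g monoid \<Rightarrow> ('g, 'k::td_local_field) analytic_structure \<Rightarrow> bool" where
  "lie_group G M \<longleftrightarrow>
     group G \<and> analytic_manifold M \<and> topspace (mtop M) = carrier G \<and> Hausdorff_space (mtop M) \<and>
     analytic_map (product_manifold M M) M (\<lambda>(x, y). x \<otimes>\<^bsub>G\<^esub> y) \<and>
     analytic_map M M (\<lambda>x. inv\<^bsub>G\<^esub> x)"

definition iterated_kernel :: "'g monoid \<Rightarrow> ('g \<Rightarrow> 'g) \<Rightarrow> 'g set" where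
  "iterated_kernel G \<alpha> = (\<Union>n. kernel G G (\<alpha> ^^ n))"

definition relatively_compact :: "'g topology \<Rightarrow> 'g set \<Rightarrow> bool" where
  "relatively_compact T S \<longleftrightarrow> compactin T (T closure_of S)"

text \<open>In a regressive trajectory \<open>x\<close>, the entry \<open>x n\<close> stands for \<open>x\<^sub>-\<^sub>n\<close>.\<close>

definition regressive_trajectory :: "'g monoid \<Rightarrow> ('g \<Rightarrow> 'g) \<Rightarrow> 'g \<Rightarrow> (nat \<Rightarrow> 'g) \<Rightarrow> bool" where
  "regressive_trajectory G \<alpha> x0 x \<longleftrightarrow>
     (\<forall>n. x n \<in> carrier G) \<and> x 0 = x0 \<and> (\<forall>n. \<alpha> (x (Suc n)) = x n)"

definition con_minus :: "'g monoid \<Rightarrow> 'g topology \<Rightarrow> ('g \<Rightarrow> 'g) \<Rightarrow> 'g set" where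
  "con_minus G T \<alpha> =
     {x0 \<in> carrier G. \<exists>x. regressive_trajectory G \<alpha> x0 x \<and> limitin T x \<one>\<^bsub>G\<^esub> sequentially}"

definition par :: "'g monoid \<Rightarrow> 'g topology \<Rightarrow> ('g \<Rightarrow> 'g) \<Rightarrow> 'g set" where
  "par G T \<alpha> = {x0 \<in> carrier G. relatively_compact T (range (\<lambda>n. (\<alpha> ^^ n) x0))}"

definition par_minus :: "'g monoid \<Rightarrow> 'g topology \<Rightarrow> ('g \<Rightarrow> 'g) \<Rightarrow> 'g set" where
  "par_minus G T \<alpha> =
     {x0 \<in> carrier G. \<exists>x. regressive_trajectory G \<alpha> x0 x \<and> relatively_compact T (range x)}"

definition lev :: "'g monoid \<Rightarrow> 'g topology \<Rightarrow> ('g \<Rightarrow> 'g) \<Rightarrow> 'g set" where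
  "lev G T \<alpha> = par G T \<alpha> \<inter> par_minus G T \<alpha>"


subsection \<open>Local invariant manifolds around the neutral element\<close>

text \<open>The parameter \<open>Es\<close> is the family of characteristic subspaces of the tangent map of \<open>\<alpha>\<close> at
  the neutral element, \<open>R\<close> its set of characteristic values.\<close>

definition centre_manifold ::
    "'g monoid \<Rightarrow> ('g, 'k::td_local_field) analytic_structure \<Rightarrow> ('g \<Rightarrow> 'g) \<Rightarrow>
     (real \<Rightarrow> (('g, 'k) chart \<times> nat \<Rightarrow> 'k) set) \<Rightarrow> nat \<Rightarrow> 'g set \<Rightarrow> bool" where
  "centre_manifold G M \<alpha> Es d N \<longleftrightarrow>
     submanifold M d N \<and> \<one>\<^bsub>G\<^esub> \<in> N \<and> \<alpha> ` N = N \<and> sub_tangent_space M d N \<one>\<^bsub>G\<^esub> = Es 1"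

definition local_unstable_manifold ::
    "'g monoid \<Rightarrow> ('g, 'k::td_local_field) analytic_structure \<Rightarrow> ('g \<Rightarrow> 'g) \<Rightarrow> real set \<Rightarrow>
     (real \<Rightarrow> (('g, 'k) chart \<times> nat \<Rightarrow> 'k) set) \<Rightarrow> nat \<Rightarrow> 'g set \<Rightarrow> bool" where
  "local_unstable_manifold G M \<alpha> R Es d N \<longleftrightarrow>
     submanifold M d N \<and> \<one>\<^bsub>G\<^esub> \<in> N \<and>
     (\<exists>b\<ge>1. b \<notin> R \<and> (\<forall>\<rho>\<in>R. \<rho> > 1 \<longrightarrow> b < \<rho>) \<and>
        sub_tangent_space M d N \<one>\<^bsub>G\<^esub> = sum_of_subspaces {b<..} Es) \<and>
     (\<exists>P. openin (subtopology (mtop M) N) P \<and> \<one>\<^bsub>G\<^esub> \<in> P \<and> \<alpha> ` P \<subseteq> N)"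

definition local_centre_unstable_manifold ::
    "'g monoid \<Rightarrow> ('g, 'k::td_local_field) analytic_structure \<Rightarrow> ('g \<Rightarrow> 'g) \<Rightarrow>
     (real \<Rightarrow> (('g, 'k) chart \<times> nat \<Rightarrow> 'k) set) \<Rightarrow> nat \<Rightarrow> 'g set \<Rightarrow> bool" where
  "local_centre_unstable_manifold G M \<alpha> Es d N \<longleftrightarrow>
     submanifold M d N \<and> \<one>\<^bsub>G\<^esub> \<in> N \<and>
     sub_tangent_space M d N \<one>\<^bsub>G\<^esub> = sum_of_subspaces {1..} Es \<and>
     (\<exists>P. openin (subtopology (mtop M) N) P \<and> \<one>\<^bsub>G\<^esub> \<in> P \<and> \<alpha> ` P \<subseteq> N)"

text \<open>\<open>L\<close> is a Lie group structure on the subgroup \<open>H\<close> of \<open>G\<close> having an open subset which is a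
  submanifold of \<open>G\<close> with property \<open>Q\<close>, and on which \<open>L\<close> and \<open>M\<close> induce the same structure.\<close>

definition lie_structure_with_open_subset ::
    "'g monoid \<Rightarrow> ('g, 'k::td_local_field) analytic_structure \<Rightarrow> 'g set \<Rightarrow> (nat \<Rightarrow> 'g set \<Rightarrow> bool) \<Rightarrow>
     ('g, 'k) analytic_structure \<Rightarrow> bool" where
  "lie_structure_with_open_subset G M H Q L \<longleftrightarrow>
     lie_group (G\<lparr>carrier := H\<rparr>) L \<and>
     (\<exists>d N. openin (mtop L) N \<and> submanifold M d N \<and> Q d N \<and>
        induced_structure L (mdim L) N = induced_structure M d N)"

end

theory Submission
  imports Defs
begin

text \<open>
  Being discrete is a local question at the neutral element, so it suffices to work in a chart
  adapted to the invariant manifold \<open>N\<close>, where \<open>\<alpha>\<close> becomes a map \<open>f\<close> fixing a point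
  \<open>x\<^sub>0\<close>, with derivative \<open>L\<close> there. On the tangent space of \<open>N\<close> the map \<open>L\<close> is annihilated by a
  polynomial over the algebraic closure whose roots are eigenvalues with absolute value in the
  prescribed range.

  If all roots are nonzero, the polynomial expresses \<open>h\<close> through \<open>L h, L\<^sup>2 h, \<dots>\<close>. This gives
  \<open>|h| \<le> C |L h|\<close>, so \<open>f\<close> does not take the value \<open>x\<^sub>0\<close> at other points of \<open>N\<close> near \<open>x\<^sub>0\<close>,
  which is (b) and (c). If all roots have absolute value 1, then \<open>\<parallel>h\<parallel> = max |L\<^sup>j h|\<close>, taken over
  \<open>j\<close> up to the degree, is an ultrametric norm with \<open>\<parallel>L h\<parallel> = \<parallel>h\<parallel>\<close>. Hence
  \<open>\<parallel>f x - x\<^sub>0\<parallel> = \<parallel>x - x\<^sub>0\<parallel>\<close> on a ball in \<open>N\<close>; the ball is invariant, and no point other than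
  \<open>x\<^sub>0\<close> is ever mapped to \<open>x\<^sub>0\<close>. This is (a).
\<close>

(* As simp rules these would break up equations between functions. *)
declare plus_fun_apply [simp del] zero_fun_apply [simp del] minus_apply [simp del]

section \<open>Absolute values\<close>

text \<open>The absolute values are given with the triangle inequality only, while the estimates
  below need the ultrametric one. For \<open>av\<close> it comes from total disconnectedness, which
  bounds the integers. The algebraic closure carries no topology here, but \<open>avc\<close>
  extends \<open>av\<close>, so it is bounded on the integers as well, and this makes it
  ultrametric. Iterating \<open>|h| \<le> C |L h|\<close> would not give (a), since orbits may leave
  the region where the linear approximation is good. An exact isometry prevents this, and for an
  ultrametric norm it survives a small perturbation. Derivatives are defined by difference quotients
  in coordinates and tangent vectors are families indexed by charts. A chain rule for remainder
  estimates is what links polynomial relations for the tangent map to the matrix of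
  \<open>\<alpha>\<close> in one adapted chart.\<close>

lemma absolute_value_of_nat_le_1I:
  assumes "absolute_value av" and "\<And>n. av (of_nat n * u) \<le> B" and "u \<noteq> 0"
  shows "av (of_nat n) \<le> 1"
proof (rule ccontr)
  assume "\<not> av (of_nat n) \<le> 1"
  then have gt: "av (of_nat n) > 1" by simp
  have mult: "av (x * y) = av x * av y" for x y
    using assms(1) by (auto simp: absolute_value_def)
  have pos: "av u > 0"
    using assms(1,3) unfolding absolute_value_def by (metis order_le_less)
  have one: "av 1 = 1"
    using mult[of 1 u] pos by simp
  have pow: "av (of_nat (n ^ k)) = av (of_nat n) ^ k" for k
    by (induction k) (auto simp: one mult)
  obtain k where k: "B / av u < av (of_nat n) ^ k"
    using gt real_arch_pow by blast
  \<comment> \<open>The power \<open>n ^ k\<close> is again a natural number, so the bound on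
    multiples of \<open>u\<close> applies to it, although its absolute value grows with
    \<open>k\<close>.\<close>
  have "av (of_nat (n ^ k)) * av u \<le> B"
    using assms(2)[of "n ^ k"] by (simp only: mult)
  with k pow pos show False
    by (simp add: field_simps)
qed

lemma absolute_value_power:
  assumes "absolute_value av"
  shows "av (x ^ n) = av x ^ n"
proof -
  have mult: "av (x * y) = av x * av y" for x y
    using assms by (auto simp: absolute_value_def)
  have "av 1 * av 1 = av 1" "av 1 \<noteq> 0"
    using mult[of 1 1] assms by (auto simp: absolute_value_def)
  then have "av 1 = 1" by simp
  then show ?thesis by (induction n) (auto simp: mult)
qed

lemma absolute_value_sum_le:
  assumes "absolute_value av"
  shows "av (sum f A) \<le> (\<Sum>x\<in>A. av (f x))"
proof -
  have zero: "av 0 = 0" using assms unfolding absolute_value_def by blast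
  show ?thesis
  proof (induction A rule: infinite_finite_induct)
    case (insert x A)
    have "av (f x + sum f A) \<le> av (f x) + av (sum f A)"
      using assms by (auto simp: absolute_value_def)
    with insert show ?case by simp
  qed (use zero in simp_all)
qed

text \<open>The binomial theorem gives \<open>|x + y|\<^sup>n \<le> (n + 1) (max |x| |y|)\<^sup>n\<close>; take \<open>n\<close>-th roots.\<close>

lemma absolute_value_ultrametric:
  fixes av :: "'a::field \<Rightarrow> real"
  assumes av: "absolute_value av" and le: "\<And>n. av (of_nat n) \<le> 1"
  shows "av (x + y) \<le> max (av x) (av y)"
proof (rule ccontr)
  assume neg: "\<not> ?thesis"
  define m where "m = max (av x) (av y)"
  have mult: "av (x * y) = av x * av y" and nn: "av x \<ge> 0" for x y
    using av by (auto simp: absolute_value_def)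
  have m0: "m \<ge> 0" unfolding m_def using nn[of x] by simp
  have bd: "av (x + y) ^ n \<le> real (Suc n) * m ^ n" for n
  proof -
    have "av (x + y) ^ n = av ((x + y) ^ n)"
      by (simp add: absolute_value_power[OF av])
    also have "\<dots> = av (\<Sum>k\<le>n. of_nat (n choose k) * x ^ k * y ^ (n - k))"
      by (simp add: binomial_ring)
    also have "\<dots> \<le> (\<Sum>k\<le>n. av (of_nat (n choose k) * x ^ k * y ^ (n - k)))"
      by (rule absolute_value_sum_le[OF av])
    also have "\<dots> \<le> (\<Sum>k\<le>n. m ^ n)"
    proof (rule sum_mono)
      fix k assume "k \<in> {..n}"
      then have eq: "m ^ n = m ^ k * m ^ (n - k)"
        by (simp flip: power_add)
      have "av (of_nat (n choose k)) * (av x ^ k * av y ^ (n - k)) \<le> 1 * (m ^ k * m ^ (n - k))"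
        by (intro mult_mono power_mono le nn mult_nonneg_nonneg zero_le_power m0)
          (auto simp: m_def)
      then show "av (of_nat (n choose k) * x ^ k * y ^ (n - k)) \<le> m ^ n"
        by (simp add: mult absolute_value_power[OF av] eq mult.assoc)
    qed
    finally show ?thesis by simp
  qed
  have lt: "m < av (x + y)" using neg unfolding m_def by linarith
  have "m > 0"
  proof (rule ccontr)
    assume "\<not> m > 0"
    with m0 have "m = 0" by simp
    with bd[of 1] lt show False by simp
  qed
  \<comment> \<open>After division by the \<open>n\<close>-th power of \<open>av (x + y)\<close>,
    the bound \<open>bd\<close> says that 1 is at most \<open>(n + 1) * q ^ n\<close>. Since
    \<open>q < 1\<close>, this fails in the limit.\<close>
  define q where "q = m / av (x + y)"
  have q: "0 < q" "q < 1" using lt \<open>m > 0\<close> by (auto simp: q_def)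
  have "1 \<le> real (Suc n) * q ^ n" for n
    using bd[of n] lt \<open>m > 0\<close> by (simp add: q_def power_divide field_simps)
  moreover have "(\<lambda>n. real (Suc n) * q ^ n) \<longlonglongrightarrow> 0"
  proof -
    have "(\<lambda>n. real n * q ^ n + q ^ n) \<longlonglongrightarrow> 0 + 0"
      using q by (intro tendsto_add LIMSEQ_power_zero powser_times_n_limit_0) auto
    then show ?thesis by (simp add: algebra_simps)
  qed
  ultimately have "(1::real) \<le> 0"
    by (intro LIMSEQ_le_const) auto
  then show False by simp
qed

text \<open>No topology is involved, so that the same facts serve \<open>av\<close> on the local
  field and \<open>avc\<close> on its algebraic closure.\<close>

locale ultrametric_value =
  fixes av :: "'a::field \<Rightarrow> real"
  assumes absolute_value: "absolute_value av"
    and ultrametric: "av (x + y) \<le> max (av x) (av y)"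
begin

lemma nonneg [simp]: "0 \<le> av x"
  and eq_0_iff [simp]: "av x = 0 \<longleftrightarrow> x = 0"
  and mult: "av (x * y) = av x * av y"
  using absolute_value by (auto simp: absolute_value_def)

lemma zero [simp]: "av 0 = 0" by simp

lemma pos_iff [simp]: "0 < av x \<longleftrightarrow> x \<noteq> 0"
  using nonneg[of x] eq_0_iff[of x] by linarith

lemma power: "av (x ^ n) = av x ^ n"
  by (rule absolute_value_power[OF absolute_value])

lemma one [simp]: "av 1 = 1"
  using power[of 1 0] by simp

lemma minus [simp]: "av (- x) = av x"
proof -
  have "av (-1) ^ 2 = 1" by (simp flip: power)
  then have "av (-1) = 1" using nonneg[of "-1"] by (auto simp: power2_eq_1_iff)
  then show ?thesis using mult[of "-1" x] by simp
qed

lemma diff_le: "av (x - y) \<le> max (av x) (av y)"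
  using ultrametric[of x "- y"] by simp

lemma divide: "av (x / y) = av x / av y"
proof (cases "y = 0")
  case False
  then show ?thesis using mult[of "x / y" y] by (simp add: field_simps)
qed simp

lemma sum_le:
  assumes "\<And>i. i \<in> A \<Longrightarrow> av (f i) \<le> B" "0 \<le> B"
  shows "av (sum f A) \<le> B"
  using assms(1)
proof (induction A rule: infinite_finite_induct)
  case (insert x A)
  then have "av (f x) \<le> B" "av (sum f A) \<le> B" by auto
  with insert(1,2) ultrametric[of "f x" "sum f A"] show ?case by simp
qed (auto simp: assms)

text \<open>In a vanishing sum each term is minus the sum of the others, so it is no larger than the
  largest of them. This is how polynomial relations between iterates will be solved for a single
  iterate.\<close>

lemma sum_isolate:
  assumes "finite A" "k \<in> A" "(\<Sum>j\<in>A. f j) = 0" "0 \<le> B"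
    and "\<And>j. j \<in> A \<Longrightarrow> j \<noteq> k \<Longrightarrow> av (f j) \<le> B"
  shows "av (f k) \<le> B"
proof -
  have "f k = - (\<Sum>j\<in>A - {k}. f j)"
    using assms(1-3) by (simp add: sum.remove[of A k] eq_neg_iff_add_eq_0)
  then have "av (f k) = av (\<Sum>j\<in>A - {k}. f j)" by simp
  also have "\<dots> \<le> B" using assms(4,5) by (intro sum_le) auto
  finally show ?thesis .
qed

lemma prod: "av (prod f A) = (\<Prod>i\<in>A. av (f i))"
  by (induction A rule: infinite_finite_induct) (auto simp: mult)

text \<open>The inserted 0 makes the maximum meaningful for \<open>n = 0\<close>. Only the first
  \<open>n\<close> entries count, so this is a norm on \<open>coord_space n\<close> and a seminorm
  elsewhere.\<close>

definition vnorm :: "nat \<Rightarrow> (nat \<Rightarrow> 'a) \<Rightarrow> real" where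
  "vnorm n h = Max (insert 0 ((\<lambda>i. av (h i)) ` {..<n}))"

lemma vnorm_le_iff: "vnorm n h \<le> B \<longleftrightarrow> 0 \<le> B \<and> (\<forall>i<n. av (h i) \<le> B)"
  unfolding vnorm_def by (subst Max_le_iff) auto

lemma vnorm_less_iff: "vnorm n h < B \<longleftrightarrow> 0 < B \<and> (\<forall>i<n. av (h i) < B)"
  unfolding vnorm_def by (subst Max_less_iff) auto

lemma vnorm_nonneg [simp]: "0 \<le> vnorm n h"
  unfolding vnorm_def by (rule Max_ge) auto

lemma le_vnorm: "i < n \<Longrightarrow> av (h i) \<le> vnorm n h"
  unfolding vnorm_def by (rule Max_ge) auto

lemma vnorm_0 [simp]: "vnorm n 0 = 0"
  by (rule antisym) (auto simp: vnorm_le_iff zero_fun_apply)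

lemma vnorm_add: "vnorm n (g + h) \<le> max (vnorm n g) (vnorm n h)"
proof -
  have "av (g i + h i) \<le> max (vnorm n g) (vnorm n h)" if "i < n" for i
    using ultrametric[of "g i" "h i"] le_vnorm[OF that, of g] le_vnorm[OF that, of h] by linarith
  moreover have "0 \<le> max (vnorm n g) (vnorm n h)"
    using vnorm_nonneg[of n g] by linarith
  ultimately show ?thesis by (auto simp only: vnorm_le_iff plus_fun_apply)
qed

lemma vnorm_minus [simp]: "vnorm n (- h) = vnorm n h"
  by (simp add: vnorm_def)

lemma vnorm_eq_0D:
  assumes "vnorm n h = 0" "h \<in> coord_space n"
  shows "h = 0"
proof
  fix i show "h i = 0 i"
    using assms le_vnorm[of i n h] nonneg[of "h i"]
    by (cases "i < n") (auto simp: coord_space_def zero_fun_apply intro: antisym)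
qed

end

section \<open>The ultrametric inequality on a local field\<close>

locale local_value = ultrametric_value av for av :: "'a::td_local_field \<Rightarrow> real" +
  assumes induces_topology: "induces_topology av"

text \<open>Proved from the triangle inequality, because it is used before the ultrametric
  inequality is available.\<close>

lemma open_ball_value:
  fixes av :: "'a::td_local_field \<Rightarrow> real"
  assumes "absolute_value av" "induces_topology av"
  shows "open {y. av (y - x) < r}"
proof -
  have "\<exists>e>0. \<forall>z. av (z - y) < e \<longrightarrow> av (z - x) < r" if "av (y - x) < r" for y
  proof (intro exI[of _ "r - av (y - x)"] conjI allI impI)
    fix z assume "av (z - y) < r - av (y - x)"
    moreover have "av ((z - y) + (y - x)) \<le> av (z - y) + av (y - x)"
      using assms(1) unfolding absolute_value_def by blast
    ultimately show "av (z - x) < r" by simp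
  qed (use that in simp)
  then show ?thesis
    using assms(2)[unfolded induces_topology_def, THEN spec, of "{y. av (y - x) < r}"] by simp
qed

lemma open_valueD:
  assumes "induces_topology av" "open U" "x \<in> U"
  shows "\<exists>r>0. \<forall>y. av (y - x) < r \<longrightarrow> y \<in> U"
  using assms unfolding induces_topology_def by blast

lemma exists_small_value:
  fixes av :: "'a::td_local_field \<Rightarrow> real"
  assumes "absolute_value av" "induces_topology av" "0 < r"
  shows "\<exists>t. t \<noteq> 0 \<and> av t < r"
proof (rule ccontr)
  assume "\<not> ?thesis"
  moreover have "av 0 = 0"
    using assms(1) by (simp add: absolute_value_def)
  ultimately have "{y. av (y - 0) < r} = {0}"
    using assms(3) by (auto simp del: One_nat_def)
  then show False
    using open_ball_value[OF assms(1,2), of 0 r] not_open_zero by metis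
qed

text \<open>A compact open neighbourhood of \<open>0\<close> is stable under translation by small elements \<open>u\<close>,
  hence contains all multiples of \<open>u\<close>.\<close>

lemma bounded_multiples:
  fixes av :: "'a::td_local_field \<Rightarrow> real"
  assumes av: "absolute_value av" "induces_topology av"
  shows "\<exists>u B. u \<noteq> 0 \<and> (\<forall>n. av (of_nat n * u) \<le> B)"
proof -
  have tri: "av (x + y) \<le> av x + av y" and zero: "av 0 = 0" for x y
    using av(1) unfolding absolute_value_def by blast+
  obtain O' C where OC: "open O'" "compact C" "(0::'a) \<in> O'" "O' \<subseteq> C"
    using locally_compact[of "0::'a"] by (elim exE conjE)
  have lc: "locally_compact_space (euclidean :: 'a topology)"
    unfolding locally_compact_space_def
  proof
    fix x :: 'a
    obtain U C where "open U" "compact C" "x \<in> U" "U \<subseteq> C"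
      using locally_compact[of x] by (elim exE conjE)
    then show "\<exists>U C. openin euclidean U \<and> compactin euclidean C \<and> x \<in> U \<and> U \<subseteq> C"
      by (intro exI[of _ U] exI[of _ C]) simp
  qed
  have T2: "Hausdorff_space (euclidean :: 'a topology)"
    unfolding Hausdorff_space_def using hausdorff by (fastforce simp: disjnt_def)
  have comp: "{0::'a} \<in> connected_components_of euclidean"
  proof -
    have "connected_component_of_set euclidean (0::'a) = {0}"
    proof -
      have "connected (connected_component_of_set euclidean (0::'a))"
        by (metis connectedin_connected_component_of connectedin_iff_connected)
      then obtain a where "connected_component_of_set euclidean (0::'a) \<subseteq> {a}"
        using totally_disconnected by blast
      moreover have "0 \<in> connected_component_of_set euclidean (0::'a)"
        by (simp add: connected_component_of_refl)
      ultimately show ?thesis by blast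
    qed
    then show ?thesis
      by (metis UNIV_I connected_component_in_connected_components_of topspace_euclidean)
  qed
  define r where "r = (SOME r. r > 0 \<and> (\<forall>y. av (y - 0) < r \<longrightarrow> y \<in> O'))"
  have r: "r > 0" "\<And>y. av y < r \<Longrightarrow> y \<in> O'"
    using someI_ex[OF open_valueD[OF av(2) OC(1,3)]] by (auto simp: r_def)
  have opr: "open {y. av y < r}" using open_ball_value[OF av, of 0 r] by simp
  \<comment> \<open>In a locally compact Hausdorff space a compact component and a disjoint closed
    set can be separated by a clopen set. Applied to the component {0} and the complement of the
    ball of radius \<open>r\<close>, this yields a clopen neighbourhood of 0 inside that
    ball.\<close>
  have "separated_between euclidean {0::'a} (- {y. av y < r})"
    using r(1)
    by (intro separated_between_compact_connected_component lc T2 comp)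
      (auto simp: disjnt_def zero opr closed_Compl)
  then obtain U where U: "closed U" "open U" "0 \<in> U" "U \<subseteq> {y. av y < r}"
    unfolding separated_between by auto
  have "compact U"
  proof -
    have "U = C \<inter> U" using U(4) r(2) OC(4) by auto
    then show ?thesis using OC(2) U(1) by (metis compact_Int_closed)
  qed
  define R where "R u = (SOME e. e > 0 \<and> (\<forall>y. av (y - u) < e \<longrightarrow> y \<in> U))" for u
  have R: "R u > 0" "\<And>y. av (y - u) < R u \<Longrightarrow> y \<in> U" if "u \<in> U" for u
    using someI_ex[OF open_valueD[OF av(2) U(2) that]] by (auto simp: R_def)
  have "\<forall>u\<in>U. open {y. av (y - u) < R u / 2}"
    using open_ball_value[OF av] by blast
  moreover have "U \<subseteq> (\<Union>u\<in>U. {y. av (y - u) < R u / 2})"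
    using R(1) by (auto simp: zero intro!: bexI)
  ultimately obtain F where F: "F \<subseteq> U" "finite F" "U \<subseteq> (\<Union>u\<in>F. {y. av (y - u) < R u / 2})"
    using compactE_image[OF \<open>compact U\<close>, of U "\<lambda>u. {y. av (y - u) < R u / 2}"] by blast
  \<comment> \<open>A Lebesgue number of the cover: a point of \<open>U\<close> is within half the
    radius of some centre in \<open>F\<close>, so moving it by less than \<open>e\<close> stays in
    the full ball and thus in \<open>U\<close>.\<close>
  define e where "e = Min ((\<lambda>u. R u / 2) ` F)"
  have "F \<noteq> {}" using F(3) U(3) by auto
  then have e: "e > 0"
    using F(1,2) R(1) by (auto simp: e_def)
  have e': "e \<le> R u / 2" if "u \<in> F" for u
    unfolding e_def using F(2) that by (intro Min_le) auto
  have step: "v + y \<in> U" if v: "v \<in> U" "av y < e" for v y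
  proof -
    obtain u where u: "u \<in> F" "av (v - u) < R u / 2" using F(3) v(1) by blast
    have "av ((v - u) + y) < R u"
      using tri[of "v - u" y] u(2) v(2) e'[OF u(1)] by linarith
    then have "av (v + y - u) < R u" by (simp add: algebra_simps)
    then show ?thesis using R(2)[of u] u(1) F(1) by blast
  qed
  obtain u where u: "u \<noteq> 0" "av u < e" using exists_small_value[OF av e] by blast
  have "of_nat n * u \<in> U" for n
  proof (induction n)
    case (Suc n)
    then show ?case using step[OF Suc u(2)] by (simp add: algebra_simps)
  qed (use U in simp)
  then have "\<forall>n. av (of_nat n * u) \<le> r" using U(4) by (fastforce intro: less_imp_le)
  then show ?thesis using u(1) by blast
qed

lemma td_local_field_of_nat_le_1:
  fixes av :: "'a::td_local_field \<Rightarrow> real"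
  assumes av: "absolute_value av" "induces_topology av"
  shows "av (of_nat n) \<le> 1"
  using bounded_multiples[OF av] absolute_value_of_nat_le_1I[OF av(1)] by metis

lemma local_valueI:
  assumes "absolute_value av" "induces_topology av"
  shows "local_value av"
  by unfold_locales
    (use assms absolute_value_ultrametric td_local_field_of_nat_le_1 in blast)+

section \<open>Differentiability\<close>

context local_value
begin

text \<open>Only the first \<open>m\<close> factors of a product neighbourhood matter, since the
  entries of \<open>h\<close> from index \<open>m\<close> on vanish. With
  \<open>openin_vnorm_ball\<close> this says that \<open>vnorm m\<close> describes the topology of
  \<open>coord_space m\<close>.\<close>

lemma openin_coord_spaceD:
  assumes "openin (top_of_set (coord_space m)) V" "x \<in> V"
  shows "\<exists>d>0. \<forall>h\<in>coord_space m. vnorm m h < d \<longrightarrow> x + h \<in> V"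
proof -
  obtain T where T: "open T" "V = coord_space m \<inter> T"
    using assms(1) by (auto simp: openin_open)
  have "openin (product_topology (\<lambda>i. euclidean) UNIV) T" "x \<in> T"
    using T assms(2) by (auto simp: open_fun_def)
  from product_topology_open_contains_basis[OF this]
  obtain W where W: "x \<in> PiE UNIV W" "\<And>i. open (W i)" "PiE UNIV W \<subseteq> T"
    by auto
  define R where "R i = (SOME r. r > 0 \<and> (\<forall>y. av (y - x i) < r \<longrightarrow> y \<in> W i))" for i
  have R: "R i > 0 \<and> (\<forall>y. av (y - x i) < R i \<longrightarrow> y \<in> W i)" for i
    unfolding R_def using W(1)
    by (intro someI_ex[OF open_valueD[OF induces_topology W(2)]]) (auto simp: PiE_iff)
  define d where "d = Min (insert 1 (R ` {..<m}))"
  have d: "d > 0" using R by (auto simp: d_def)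
  have dR: "d \<le> R i" if "i < m" for i
    unfolding d_def using that by (intro Min_le) auto
  have "x + h \<in> V" if h: "h \<in> coord_space m" "vnorm m h < d" for h
  proof -
    have x: "x \<in> coord_space m" using assms(2) T(2) by auto
    have "x i + h i \<in> W i" for i
    proof (cases "i < m")
      case True
      then have "av (h i) < R i"
        using le_vnorm[OF True, of h] h(2) dR[OF True] by linarith
      then show ?thesis using R[of i] by simp
    next
      case False
      then have "h i = 0" using h(1) by (auto simp: coord_space_def)
      then show ?thesis using W(1) by (auto simp: PiE_iff)
    qed
    then have "x + h \<in> T" using W(3) by (auto simp: plus_fun_def PiE_iff)
    moreover have "x + h \<in> coord_space m"
      using x h(1) by (auto simp: coord_space_def plus_fun_def)
    ultimately show ?thesis using T(2) by auto
  qed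
  with d show ?thesis by blast
qed

lemma openin_vnorm_ball:
  "openin (top_of_set (coord_space m)) {y \<in> coord_space m. vnorm m (y - x) < d}"
proof (cases "d > 0")
  case True
  have "open {y. \<forall>i\<in>{..<m}. y (id i) \<in> {z. av (z - x i) < d}}"
    by (rule product_topology_basis')
      (auto simp: open_ball_value[OF absolute_value induces_topology])
  moreover have "{y \<in> coord_space m. vnorm m (y - x) < d} =
      coord_space m \<inter> {y. \<forall>i\<in>{..<m}. y (id i) \<in> {z. av (z - x i) < d}}"
    using True by (auto simp: vnorm_less_iff minus_apply)
  ultimately show ?thesis by (simp add: openin_open_Int)
next
  case False
  have "\<not> vnorm m h < d" for h
    using False vnorm_nonneg[of m h] by linarith
  then have "{y \<in> coord_space m. vnorm m (y - x) < d} = {}" by blast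
  then show ?thesis by (simp only: openin_empty)
qed

section \<open>Infinite sums and power series over an ultrametric field\<close>

lemma has_sum_eventually_close:
  assumes "(f has_sum s) A" "0 < e"
  shows "\<exists>F\<subseteq>A. finite F \<and> (\<forall>F'. finite F' \<and> F \<subseteq> F' \<and> F' \<subseteq> A \<longrightarrow> av (sum f F' - s) < e)"
proof -
  have "eventually (\<lambda>F. sum f F \<in> {y. av (y - s) < e}) (finite_subsets_at_top A)"
    using assms open_ball_value[OF absolute_value induces_topology, of s e]
    unfolding has_sum_def by (intro topological_tendstoD) auto
  then show ?thesis
    unfolding eventually_finite_subsets_at_top by auto
qed

text \<open>Outside a suitable finite set each term is a difference of two partial sums, both within
  distance 1 of the limit.\<close>

lemma has_sum_bounded:
  assumes "(f has_sum s) A"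
  shows "\<exists>C\<ge>0. \<forall>a\<in>A. av (f a) \<le> C"
proof -
  obtain F where F: "F \<subseteq> A" "finite F"
    and close: "\<And>F'. finite F' \<Longrightarrow> F \<subseteq> F' \<Longrightarrow> F' \<subseteq> A \<Longrightarrow> av (sum f F' - s) < 1"
    using has_sum_eventually_close[OF assms, of 1] by auto
  define C where "C = Max (insert 1 ((\<lambda>a. av (f a)) ` F))"
  have C: "1 \<le> C" unfolding C_def using F by (intro Max_ge) auto
  have "av (f a) \<le> C" if "a \<in> A" for a
  proof (cases "a \<in> F")
    case True
    then show ?thesis unfolding C_def using F by (intro Max_ge) auto
  next
    case False
    then have "f a = (sum f (insert a F) - s) - (sum f F - s)" using F by simp
    then have "av (f a) \<le> max (av (sum f (insert a F) - s)) (av (sum f F - s))"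
      by (metis diff_le)
    also have "\<dots> \<le> 1"
      using close[of "insert a F"] close[of F] F that by (auto intro: less_imp_le)
    finally show ?thesis using C by simp
  qed
  with C show ?thesis by (intro exI[of _ C]) auto
qed

text \<open>In place of a convergent majorant, the ultrametric inequality bounds every finite piece
  of the tail by its largest term. If the tail exceeded \<open>B\<close>, a partial sum close enough
  to \<open>s\<close> would contradict this.\<close>

lemma has_sum_tail_le:
  assumes "(f has_sum s) A" "finite F" "F \<subseteq> A" "0 \<le> B" "\<And>a. a \<in> A - F \<Longrightarrow> av (f a) \<le> B"
  shows "av (s - sum f F) \<le> B"
proof (rule ccontr)
  assume neg: "\<not> ?thesis"
  define e where "e = av (s - sum f F)"
  have e: "e > B" "e > 0" using neg assms(4) by (auto simp: e_def)
  obtain F1 where F1: "F1 \<subseteq> A" "finite F1"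
    and close: "\<And>F'. finite F' \<Longrightarrow> F1 \<subseteq> F' \<Longrightarrow> F' \<subseteq> A \<Longrightarrow> av (sum f F' - s) < e"
    using has_sum_eventually_close[OF assms(1) e(2)] by auto
  let ?F = "F \<union> F1"
  have "av (sum f (?F - F)) \<le> B"
    using assms F1 by (intro sum_le) auto
  moreover have "sum f (?F - F) = sum f ?F - sum f F"
    using assms F1 by (intro sum_diff) auto
  ultimately have "av (sum f ?F - sum f F) < e" using e by simp
  moreover have "av (sum f ?F - s) < e" using close[of ?F] assms F1 by auto
  moreover have "s - sum f F = (sum f ?F - sum f F) - (sum f ?F - s)" by simp
  ultimately have "av (s - sum f F) < e"
    using diff_le[of "sum f ?F - sum f F" "sum f ?F - s"] by simp
  then show False by (simp add: e_def)
qed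

lemma av_linear_le:
  assumes "\<And>j. j < m \<Longrightarrow> av (a j) \<le> C" "0 \<le> C"
  shows "av (\<Sum>j<m. a j * h j) \<le> C * vnorm m h"
  using assms by (intro sum_le) (auto simp: mult intro!: mult_mono le_vnorm)

lemma matrix_bound:
  fixes n m :: nat
  shows "\<exists>C\<ge>1. \<forall>i<n. \<forall>j<m. av (a i j) \<le> C"
proof -
  let ?S = "insert 1 ((\<lambda>(i, j). av (a i j)) ` ({..<n} \<times> {..<m}))"
  have fin: "finite ?S" by (intro finite.insertI finite_imageI finite_cartesian_product finite_lessThan)
  have "av (a i j) \<le> Max ?S" if "i < n" "j < m" for i j
    using that by (intro Max_ge[OF fin]) auto
  moreover have "1 \<le> Max ?S" by (intro Max_ge[OF fin]) auto
  ultimately show ?thesis by blast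
qed

lemma multi_indices_support: "a \<in> multi_indices m \<Longrightarrow> a i \<noteq> 0 \<Longrightarrow> i < m"
  unfolding multi_indices_def mem_Collect_eq by (meson not_le)

text \<open>Convergence at one point with all coordinates equal to a small \<open>t\<close> bounds
  the coefficients as in Cauchy's estimates, by \<open>C / T ^ deg a\<close>. The terms of degree at
  least 2 are then at most \<open>C * (vnorm m h / T)\<^sup>2\<close>, uniformly.\<close>

lemma power_series_first_order:
  assumes "power_series_analytic_at m f x"
  shows "\<exists>a. \<forall>e>0. \<exists>d>0. \<forall>h\<in>coord_space m. vnorm m h < d \<longrightarrow>
           av (f (x + h) - f x - (\<Sum>j<m. a j * h j)) \<le> e * vnorm m h"
proof -
  obtain c V where V: "openin (top_of_set (coord_space m)) V" "0 \<in> V"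
    and sums: "\<And>h. h \<in> V \<Longrightarrow>
      ((\<lambda>a. c a * (\<Prod>i<m. h i ^ a i)) has_sum f (x + h)) (multi_indices m)"
    using assms unfolding power_series_analytic_at_def plus_fun_def zero_fun_def by blast
  obtain d0 where d0: "d0 > 0" "\<And>h. h \<in> coord_space m \<Longrightarrow> vnorm m h < d0 \<Longrightarrow> h \<in> V"
    using openin_coord_spaceD[OF V] by auto
  obtain t where t: "t \<noteq> 0" "av t < d0"
    using exists_small_value[OF absolute_value induces_topology d0(1)] by blast
  define T where "T = av t"
  have T: "T > 0" "T < d0" using t by (auto simp: T_def)
  define deg where "deg a = (\<Sum>i<m. a i)" for a :: "nat \<Rightarrow> nat"
  \<comment> \<open>The multi-index of the linear monomial in the variable \<open>j\<close>; the
    derivative is read off from these coefficients.\<close>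
  define u :: "nat \<Rightarrow> nat \<Rightarrow> nat" where "u j = (\<lambda>i. if i = j then 1 else 0)" for j
  obtain C where C: "C \<ge> 0" "\<And>a. a \<in> multi_indices m \<Longrightarrow> av (c a) * T ^ deg a \<le> C"
  proof -
    let ?h = "\<lambda>i. if i < m then t else 0"
    have "?h \<in> V"
      using T by (intro d0(2)) (auto simp: coord_space_def vnorm_less_iff T_def d0)
    from has_sum_bounded[OF sums[OF this]] obtain C where
      C: "C \<ge> 0" "\<And>a. a \<in> multi_indices m \<Longrightarrow> av (c a * (\<Prod>i<m. ?h i ^ a i)) \<le> C"
      by blast
    have "(\<Prod>i<m. ?h i ^ a i) = t ^ deg a" for a
      by (simp add: deg_def power_sum)
    with C that[of C] show ?thesis by (simp add: mult power T_def)
  qed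
  have fx: "f x = c 0"
  proof -
    have "av (f (x + 0) - (\<Sum>a\<in>{0}. c a * (\<Prod>i<m. 0 i ^ a i))) \<le> 0"
    proof (rule has_sum_tail_le[OF sums[OF V(2)]])
      fix a assume a: "a \<in> multi_indices m - {0}"
      then obtain i where i: "a i \<noteq> 0" by (auto simp: fun_eq_iff zero_fun_apply)
      with a have "i < m" by (auto intro: multi_indices_support)
      with i have "(\<Prod>i<m. (0 :: nat \<Rightarrow> 'a) i ^ a i) = 0"
        by (intro prod_zero) (auto simp: zero_fun_apply)
      then show "av (c a * (\<Prod>i<m. 0 i ^ a i)) \<le> 0"
        by (simp only: mult_zero_right zero order_refl)
    qed (auto simp: multi_indices_def zero_fun_apply)
    then have "f (x + 0) = c 0"
      using nonneg[of "f x - c 0"] by (simp add: zero_fun_apply)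
    then show ?thesis by simp
  qed
  have main: "av (f (x + h) - f x - (\<Sum>j<m. c (u j) * h j)) \<le> C * (vnorm m h / T)\<^sup>2"
    if h: "h \<in> coord_space m" "vnorm m h < T" for h
  proof -
    define N where "N = vnorm m h"
    have N: "0 \<le> N" "N < T" using h by (auto simp: N_def)
    let ?F = "insert 0 (u ` {..<m})"
    have hV: "h \<in> V" using h T by (intro d0(2)) auto
    have inj: "inj_on u {..<m}"
      by (intro inj_onI) (metis u_def zero_neq_one)
    have 0: "0 \<notin> u ` {..<m}"
    proof
      assume "0 \<in> u ` {..<m}"
      then obtain j where "u j = 0" by auto
      then have "u j j = 0 j" by simp
      then show False by (simp add: u_def zero_fun_apply)
    qed
    have prod_u: "(\<Prod>i<m. h i ^ u j i) = h j" if "j < m" for j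
    proof -
      have "(\<Prod>i<m. h i ^ u j i) = (\<Prod>i<m. if i = j then h i else 1)"
        by (intro prod.cong) (auto simp: u_def)
      then show ?thesis using that by simp
    qed
    have "av (f (x + h) - (\<Sum>a\<in>?F. c a * (\<Prod>i<m. h i ^ a i))) \<le> C * (N / T)\<^sup>2"
    proof (rule has_sum_tail_le[OF sums[OF hV]])
      fix a assume a: "a \<in> multi_indices m - ?F"
      have deg: "deg a \<ge> 2"
      proof (rule ccontr)
        assume "\<not> deg a \<ge> 2"
        moreover obtain j where j: "a j \<noteq> 0" using a by (auto simp: fun_eq_iff zero_fun_apply)
        moreover from j a have jm: "j < m" by (auto intro: multi_indices_support)
        moreover have "deg a = a j + (\<Sum>i\<in>{..<m} - {j}. a i)"
          unfolding deg_def using jm by (simp add: sum.remove)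
        ultimately have "a j = 1" "(\<Sum>i\<in>{..<m} - {j}. a i) = 0" by linarith+
        then have "a i = u j i" for i
          using a multi_indices_support[of a m i] by (cases "i < m") (auto simp: u_def sum_eq_0_iff)
        then have "a = u j" by blast
        with a jm show False by auto
      qed
      have "av (\<Prod>i<m. h i ^ a i) \<le> (\<Prod>i<m. N ^ a i)"
        unfolding prod power N_def by (intro prod_mono) (auto intro!: power_mono le_vnorm)
      also have "\<dots> = N ^ deg a" by (simp add: deg_def power_sum)
      also have "\<dots> = T ^ deg a * (N / T) ^ deg a"
        using T by (simp add: power_divide)
      also have "\<dots> \<le> T ^ deg a * (N / T)\<^sup>2"
        using N T deg by (intro mult_left_mono power_decreasing) auto
      finally have "av (c a) * av (\<Prod>i<m. h i ^ a i) \<le> av (c a) * (T ^ deg a * (N / T)\<^sup>2)"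
        by (intro mult_left_mono) auto
      also have "\<dots> \<le> C * (N / T)\<^sup>2"
        using C(2)[of a] a unfolding mult.assoc[symmetric] by (intro mult_right_mono) auto
      finally show "av (c a * (\<Prod>i<m. h i ^ a i)) \<le> C * (N / T)\<^sup>2" by (simp add: mult)
    qed (use C in \<open>auto simp: multi_indices_def u_def zero_fun_apply\<close>)
    moreover have "(\<Sum>a\<in>?F. c a * (\<Prod>i<m. h i ^ a i)) = f x + (\<Sum>j<m. c (u j) * h j)"
      using 0 prod_u by (simp add: sum.reindex[OF inj] fx zero_fun_apply)
    ultimately show ?thesis by (simp add: N_def diff_diff_eq)
  qed
  show ?thesis
  proof (intro exI[of _ "\<lambda>j. c (u j)"] allI impI)
    fix e :: real assume e: "e > 0"
    \<comment> \<open>The second entry makes the quadratic remainder at most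
      \<open>e * vnorm m h\<close>; adding 1 to \<open>C\<close> covers
      \<open>C = 0\<close>.\<close>
    define d where "d = min T (e * T\<^sup>2 / (C + 1))"
    have "av (f (x + h) - f x - (\<Sum>j<m. c (u j) * h j)) \<le> e * vnorm m h"
      if h: "h \<in> coord_space m" "vnorm m h < d" for h
    proof -
      let ?N = "vnorm m h"
      have "(C + 1) * ?N \<le> e * T\<^sup>2"
        using h(2) C(1) by (simp add: d_def field_simps)
      then have "C * ?N \<le> e * T\<^sup>2"
        using mult_right_mono[of C "C + 1" ?N] by simp
      then have "C * ?N * ?N \<le> e * T\<^sup>2 * ?N"
        by (intro mult_right_mono) auto
      then have "C * (?N / T)\<^sup>2 \<le> e * ?N"
        using T by (simp add: power_divide power2_eq_square field_simps)
      with main[OF h(1)] h(2) show ?thesis by (simp add: d_def)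
    qed
    moreover have "d > 0" using e T C by (simp add: d_def)
    ultimately show "\<exists>d>0. \<forall>h\<in>coord_space m. vnorm m h < d \<longrightarrow>
        av (f (x + h) - f x - (\<Sum>j<m. c (u j) * h j)) \<le> e * vnorm m h"
      by blast
  qed
qed

text \<open>Differentiability at \<open>x\<close> with matrix \<open>a\<close>, as a uniform
  remainder estimate. This form composes, whereas \<open>partial_deriv\<close> only records limits
  along the coordinate axes.\<close>

definition has_jacobian ::
    "nat \<Rightarrow> nat \<Rightarrow> ((nat \<Rightarrow> 'a) \<Rightarrow> nat \<Rightarrow> 'a) \<Rightarrow> (nat \<Rightarrow> nat \<Rightarrow> 'a) \<Rightarrow> (nat \<Rightarrow> 'a) \<Rightarrow> bool"
  where
  "has_jacobian m n F a x \<longleftrightarrow> (\<forall>e>0. \<exists>d>0. \<forall>h\<in>coord_space m. vnorm m h < d \<longrightarrow>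
     (\<forall>i<n. av (F (x + h) i - F x i - (\<Sum>j<m. a i j * h j)) \<le> e * vnorm m h))"

lemma analytic_has_jacobian:
  assumes "\<And>i. i < n \<Longrightarrow> power_series_analytic_at m (\<lambda>y. F y i) x"
  shows "\<exists>a. has_jacobian m n F a x"
proof -
  have "\<forall>i. \<exists>a. i < n \<longrightarrow> (\<forall>e>0. \<exists>d>0. \<forall>h\<in>coord_space m. vnorm m h < d \<longrightarrow>
      av (F (x + h) i - F x i - (\<Sum>j<m. a j * h j)) \<le> e * vnorm m h)"
    using power_series_first_order[OF assms] by blast
  then obtain a where a: "\<And>i e. i < n \<Longrightarrow> e > 0 \<Longrightarrow> \<exists>d>0. \<forall>h\<in>coord_space m. vnorm m h < d \<longrightarrow>
      av (F (x + h) i - F x i - (\<Sum>j<m. a i j * h j)) \<le> e * vnorm m h"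
    by metis
  have "has_jacobian m n F a x"
    unfolding has_jacobian_def
  proof (intro allI impI)
    fix e :: real assume e: "e > 0"
    have "\<forall>i. \<exists>d. i < n \<longrightarrow> d > 0 \<and> (\<forall>h\<in>coord_space m. vnorm m h < d \<longrightarrow>
      av (F (x + h) i - F x i - (\<Sum>j<m. a i j * h j)) \<le> e * vnorm m h)"
      using a[OF _ e] by blast
    then obtain d where d: "\<And>i. i < n \<Longrightarrow> d i > 0"
      "\<And>i h. i < n \<Longrightarrow> h \<in> coord_space m \<Longrightarrow> vnorm m h < d i \<Longrightarrow>
        av (F (x + h) i - F x i - (\<Sum>j<m. a i j * h j)) \<le> e * vnorm m h"
      by metis
    let ?d = "Min (insert 1 (d ` {..<n}))"
    have "?d > 0" using d(1) by auto
    moreover have "?d \<le> d i" if "i < n" for i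
      using that by (intro Min_le) auto
    ultimately show "\<exists>d>0. \<forall>h\<in>coord_space m. vnorm m h < d \<longrightarrow>
        (\<forall>i<n. av (F (x + h) i - F x i - (\<Sum>j<m. a i j * h j)) \<le> e * vnorm m h)"
      using d(2) by (intro exI[of _ ?d]) force
  qed
  then show ?thesis by blast
qed

lemma has_jacobian_partial_deriv:
  assumes F: "has_jacobian m n F a x" and ij: "i < n" "j < m"
  shows "partial_deriv F i j x = a i j"
proof -
  let ?q = "\<lambda>t. (F (x(j := x j + t)) i - F x i) / t"
  have "filterlim ?q (nhds (a i j)) (at 0)"
  proof (rule topological_tendstoI)
    fix S assume "open S" "a i j \<in> S"
    then obtain r where r: "r > 0" "\<And>y. av (y - a i j) < r \<Longrightarrow> y \<in> S"
      using open_valueD[OF induces_topology] by blast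
    then obtain d where d: "d > 0" "\<And>h. h \<in> coord_space m \<Longrightarrow> vnorm m h < d \<Longrightarrow>
        \<forall>i<n. av (F (x + h) i - F x i - (\<Sum>j<m. a i j * h j)) \<le> r / 2 * vnorm m h"
      using F[unfolded has_jacobian_def, rule_format, of "r / 2"] by auto
    have "?q t \<in> S" if t: "t \<noteq> 0" "av (t - 0) < d" for t
    proof (rule r(2))
      define h where "h = (\<lambda>k. if k = j then t else 0)"
      have h: "h \<in> coord_space m" using ij by (auto simp: coord_space_def h_def)
      have N: "vnorm m h = av t"
      proof (rule antisym)
        show "vnorm m h \<le> av t" by (auto simp: vnorm_le_iff h_def)
        show "av t \<le> vnorm m h" using le_vnorm[OF ij(2), of h] by (simp add: h_def)
      qed
      have "x(j := x j + t) = x + h"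
        by (auto simp: fun_eq_iff h_def plus_fun_apply)
      moreover have "(\<Sum>k<m. a i k * h k) = a i j * t"
      proof -
        have "(\<Sum>k<m. a i k * h k) = (\<Sum>k<m. if k = j then a i k * t else 0)"
          by (intro sum.cong) (auto simp: h_def)
        then show ?thesis using ij by simp
      qed
      ultimately have "av (F (x(j := x j + t)) i - F x i - a i j * t) \<le> r / 2 * av t"
        using d(2)[OF h] t N ij by auto
      moreover have "?q t - a i j = (F (x(j := x j + t)) i - F x i - a i j * t) / t"
        using t by (simp add: field_simps)
      ultimately have "av (?q t - a i j) \<le> r / 2"
        using t by (simp add: divide field_simps)
      then show "av (?q t - a i j) < r" using r by simp
    qed
    then show "eventually (\<lambda>t. ?q t \<in> S) (at 0)"
      unfolding eventually_at_topological using d(1)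
      by (intro exI[of _ "{t. av (t - 0) < d}"])
        (auto intro: open_ball_value[OF absolute_value induces_topology, of 0, simplified])
  qed
  \<comment> \<open>Non-discreteness of the field makes the limit unique, so \<open>Lim\<close>
    returns it.\<close>
  moreover have "at (0::'a) \<noteq> bot"
    using not_open_zero by (simp add: at_eq_bot_iff)
  ultimately show ?thesis
    unfolding partial_deriv_def by (intro tendsto_Lim)
qed

lemma has_jacobian_differential:
  assumes "has_jacobian m n F a x"
  shows "differential m n F x h = (\<lambda>i. if i < n then \<Sum>j<m. a i j * h j else 0)"
  using has_jacobian_partial_deriv[OF assms] by (auto simp: differential_def fun_eq_iff)

text \<open>Of the two error terms, the outer remainder and the image under \<open>b\<close> of the
  inner one, each may be as large as \<open>e * vnorm m h\<close>, since the ultrametric inequality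
  takes their maximum. The equation for \<open>H\<close> is asked on \<open>U\<close> because
  coordinate expressions compose only where the charts overlap.\<close>

lemma has_jacobian_compose:
  assumes F: "has_jacobian m n F a x" and G: "has_jacobian n p G b (F x)"
    and U: "openin (top_of_set (coord_space m)) U" "x \<in> U"
    and FU: "F ` U \<subseteq> coord_space n"
    and H: "\<And>y i. y \<in> U \<Longrightarrow> i < p \<Longrightarrow> H y i = G (F y) i"
  shows "has_jacobian m p H (\<lambda>i k. \<Sum>j<n. b i j * a j k) x"
  unfolding has_jacobian_def
proof (intro allI impI)
  fix e :: real assume e: "e > 0"
  obtain A where A: "A \<ge> 1" "\<And>i j. i < n \<Longrightarrow> j < m \<Longrightarrow> av (a i j) \<le> A"
    using matrix_bound[of n m a] by blast
  obtain B where B: "B \<ge> 1" "\<And>i j. i < p \<Longrightarrow> j < n \<Longrightarrow> av (b i j) \<le> B"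
    using matrix_bound[of p n b] by blast
  obtain d0 where d0: "d0 > 0" "\<And>h. h \<in> coord_space m \<Longrightarrow> vnorm m h < d0 \<Longrightarrow> x + h \<in> U"
    using openin_coord_spaceD[OF U] by auto
  \<comment> \<open>The bound by 1 keeps the increment of \<open>F\<close> below
    \<open>A * vnorm m h\<close>; the other bound pays for the factor \<open>B\<close> when the
    inner remainder passes through \<open>b\<close>.\<close>
  define e2 where "e2 = min 1 (e / B)"
  have e2: "e2 > 0" "e2 \<le> 1" "B * e2 \<le> e" using e B by (auto simp: e2_def field_simps min_def)
  obtain d1 where d1: "d1 > 0" "\<And>h i. h \<in> coord_space m \<Longrightarrow> vnorm m h < d1 \<Longrightarrow> i < n \<Longrightarrow>
      av (F (x + h) i - F x i - (\<Sum>j<m. a i j * h j)) \<le> e2 * vnorm m h"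
    using F[unfolded has_jacobian_def, rule_format, OF e2(1)] by auto
  define e1 where "e1 = e / A"
  have e1: "e1 > 0" "e1 * A = e" using e A by (auto simp: e1_def)
  obtain d2 where d2: "d2 > 0" "\<And>k i. k \<in> coord_space n \<Longrightarrow> vnorm n k < d2 \<Longrightarrow> i < p \<Longrightarrow>
      av (G (F x + k) i - G (F x) i - (\<Sum>j<n. b i j * k j)) \<le> e1 * vnorm n k"
    using G[unfolded has_jacobian_def, rule_format, OF e1(1)] by auto
  define d where "d = Min {d0, d1, d2 / A}"
  have d: "d > 0" "d \<le> d0" "d \<le> d1" "d \<le> d2 / A" using d0 d1 d2 A by (auto simp: d_def)
  have "av (H (x + h) i - H x i - (\<Sum>k<m. (\<Sum>j<n. b i j * a j k) * h k)) \<le> e * vnorm m h"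
    if h: "h \<in> coord_space m" "vnorm m h < d" and i: "i < p" for h i
  proof -
    let ?N = "vnorm m h"
    define k where "k = F (x + h) - F x"
    define r where "r j = k j - (\<Sum>l<m. a j l * h l)" for j
    have xh: "x + h \<in> U" using d0(2)[OF h(1)] h(2) d by simp
    have k: "k \<in> coord_space n"
      using FU xh U(2) by (auto simp: k_def coord_space_def minus_apply image_subset_iff)
    have r: "av (r j) \<le> e2 * ?N" if "j < n" for j
      using d1(2)[OF h(1) _ that] h(2) d by (simp add: r_def k_def minus_apply)
    have kj: "av (k j) \<le> A * ?N" if j: "j < n" for j
    proof -
      have "av (\<Sum>l<m. a j l * h l) \<le> A * ?N"
        using A j by (intro av_linear_le) auto
      moreover have "e2 * ?N \<le> A * ?N"
        using e2(2) A(1) by (intro mult_right_mono) auto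
      moreover have "av (k j) \<le> max (av (r j)) (av (\<Sum>l<m. a j l * h l))"
        using ultrametric[of "r j" "\<Sum>l<m. a j l * h l"] by (simp add: r_def)
      ultimately show ?thesis using r[OF j] by linarith
    qed
    then have Nk: "vnorm n k \<le> A * ?N" using A by (auto simp: vnorm_le_iff)
    have "A * ?N < A * (d2 / A)" using h(2) d A by (intro mult_strict_left_mono) auto
    then have "vnorm n k < d2" using Nk A by simp
    from d2(2)[OF k this i] have
      "av (G (F x + k) i - G (F x) i - (\<Sum>j<n. b i j * k j)) \<le> e1 * (A * ?N)"
      using Nk e1(1) by (meson mult_left_mono less_imp_le order_trans)
    moreover have "e1 * (A * ?N) = e * ?N" using e1(2) by (simp add: mult.assoc[symmetric])
    moreover have "F x + k = F (x + h)" by (simp add: k_def)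
    ultimately have
      1: "av (G (F (x + h)) i - G (F x) i - (\<Sum>j<n. b i j * k j)) \<le> e * ?N" by simp
    have 2: "av (\<Sum>j<n. b i j * r j) \<le> e * ?N"
    proof (rule sum_le)
      fix j assume j: "j \<in> {..<n}"
      have "av (b i j * r j) \<le> B * (e2 * ?N)"
        unfolding mult using B(1) i j r[of j] e2(1) by (intro mult_mono B(2)) auto
      also have "\<dots> \<le> e * ?N"
        unfolding mult.assoc[symmetric] by (intro mult_right_mono e2) auto
      finally show "av (b i j * r j) \<le> e * ?N" .
    qed (use e in auto)
    have "(\<Sum>l<m. (\<Sum>j<n. b i j * a j l) * h l) = (\<Sum>j<n. b i j * (\<Sum>l<m. a j l * h l))"
      by (simp add: sum_distrib_left sum_distrib_right mult.assoc) (rule sum.swap)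
    also have "\<dots> = (\<Sum>j<n. b i j * k j) - (\<Sum>j<n. b i j * r j)"
      by (simp add: r_def right_diff_distrib sum_subtractf)
    finally have "H (x + h) i - H x i - (\<Sum>l<m. (\<Sum>j<n. b i j * a j l) * h l) =
        (G (F (x + h)) i - G (F x) i - (\<Sum>j<n. b i j * k j)) + (\<Sum>j<n. b i j * r j)"
      using H[OF xh i] H[OF U(2) i] by simp
    then show ?thesis
      using ultrametric[of "G (F (x + h)) i - G (F x) i - (\<Sum>j<n. b i j * k j)"
          "\<Sum>j<n. b i j * r j"] 1 2 by simp
  qed
  then show "\<exists>d>0. \<forall>h\<in>coord_space m. vnorm m h < d \<longrightarrow>
      (\<forall>i<p. av (H (x + h) i - H x i - (\<Sum>k<m. (\<Sum>j<n. b i j * a j k) * h k)) \<le> e * vnorm m h)"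
    using d(1) by blast
qed

end

section \<open>Annihilating polynomials\<close>

lemma sum_fun_apply: "(\<Sum>x\<in>A. f x) y = (\<Sum>x\<in>A. f x y)"
  by (induction A rule: infinite_finite_induct) (auto simp: plus_fun_apply zero_fun_apply)

lemma fscale_apply: "fscale a u i = a * u i"
  by (simp add: fscale_def)

lemma fscale_simps:
  "fscale a (u + v) = fscale a u + fscale a v"
  "fscale (a + b) u = fscale a u + fscale b u"
  "fscale a (fscale b u) = fscale (a * b) u"
  "fscale 0 u = 0" "fscale 1 u = u" "fscale a 0 = 0" "fscale (- a) u = - fscale a u"
  by (auto simp: fscale_def fun_eq_iff algebra_simps plus_fun_apply zero_fun_apply)

lemma to_ac_comp_simps:
  "to_ac \<circ> (u + v) = (to_ac \<circ> u) + (to_ac \<circ> v)" "to_ac \<circ> 0 = 0"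
  "to_ac \<circ> fscale a u = fscale (to_ac a) (to_ac \<circ> u)"
  by (auto simp: fun_eq_iff fscale_def plus_fun_apply zero_fun_apply comp_apply)

text \<open>Linearity is required on the whole function space, so that polynomials in
  \<open>B\<close> need no domain conditions. Tangent maps and their scalar extensions are given by
  matrices and satisfy this.\<close>

locale fun_endo =
  fixes B :: "('i \<Rightarrow> 'a::field) \<Rightarrow> 'i \<Rightarrow> 'a"
  assumes add: "B (u + v) = B u + B v" and scale: "B (fscale a u) = fscale a (B u)"
begin

lemma zero [simp]: "B 0 = 0"
  using scale[of 0 0] by (simp add: fscale_simps)

lemma sum: "B (sum f A) = (\<Sum>x\<in>A. B (f x))"
  by (induction A rule: infinite_finite_induct) (simp_all add: add)

definition poly_op :: "'a poly \<Rightarrow> ('i \<Rightarrow> 'a) \<Rightarrow> 'i \<Rightarrow> 'a" where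
  "poly_op p w = (\<Sum>j\<le>Polynomial.degree p. fscale (poly.coeff p j) ((B ^^ j) w))"

lemma poly_op_altdef:
  assumes "Polynomial.degree p \<le> n"
  shows "poly_op p w = (\<Sum>j\<le>n. fscale (poly.coeff p j) ((B ^^ j) w))"
  unfolding poly_op_def using assms
  by (intro sum.mono_neutral_left) (auto simp: Polynomial.coeff_eq_0 fscale_simps)

lemma poly_op_pCons: "poly_op (pCons a p) w = fscale a w + B (poly_op p w)"
proof -
  have "poly_op (pCons a p) w = (\<Sum>j\<le>Suc (Polynomial.degree p). fscale (poly.coeff (pCons a p) j) ((B ^^ j) w))"
    by (rule poly_op_altdef) (rule Polynomial.degree_pCons_le)
  also have "\<dots> = fscale a w + B (poly_op p w)"
    by (simp add: sum.atMost_Suc_shift poly_op_def sum scale del: sum.atMost_Suc)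
  finally show ?thesis .
qed

lemma poly_op_0_left [simp]: "poly_op 0 w = 0"
  by (simp add: poly_op_def fscale_simps)

lemma poly_op_1 [simp]: "poly_op 1 w = w"
  by (simp add: one_pCons poly_op_pCons fscale_simps)

lemma poly_op_add_left: "poly_op (p + q) w = poly_op p w + poly_op q w"
  by (induction p q rule: poly_induct2)
    (simp_all add: poly_op_pCons add fscale_simps algebra_simps)

lemma poly_op_smult: "poly_op (Polynomial.smult a p) w = fscale a (poly_op p w)"
  by (induction p) (simp_all add: poly_op_pCons add scale fscale_simps)

lemma poly_op_mult: "poly_op (p * q) w = poly_op p (poly_op q w)"
  by (induction p) (simp_all add: poly_op_pCons poly_op_add_left poly_op_smult fscale_simps)

lemma poly_op_add: "poly_op p (u + v) = poly_op p u + poly_op p v"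
  by (induction p) (simp_all add: poly_op_pCons add fscale_simps algebra_simps)

lemma poly_op_scale: "poly_op p (fscale a u) = fscale a (poly_op p u)"
  by (induction p) (simp_all add: poly_op_pCons scale fscale_simps algebra_simps)

lemma poly_op_0 [simp]: "poly_op p 0 = 0"
  by (induction p) (simp_all add: poly_op_pCons fscale_simps)

lemma poly_op_linear: "poly_op [:- a, 1:] u = B u - fscale a u"
  by (simp add: poly_op_pCons fscale_simps)

lemma poly_op_commute: "poly_op p (B w) = B (poly_op p w)"
proof -
  have "poly_op (p * [:0, 1:]) w = poly_op ([:0, 1:] * p) w"
    by (simp only: mult.commute)
  then show ?thesis
    by (simp only: poly_op_mult poly_op_linear[of 0, simplified] fscale_simps diff_zero)
qed

lemma poly_op_sum: "poly_op p (sum f A) = (\<Sum>x\<in>A. poly_op p (f x))"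
  by (induction A rule: infinite_finite_induct) (simp_all add: poly_op_add)

end

text \<open>The endomorphism \<open>\<beta>\<close> of \<open>E\<close> has a globally defined extension of scalars \<open>B\<close>. This makes the
  description operator in \<^const>\<open>extend_endo\<close> harmless.\<close>

locale extended_endo = fun_endo B
  for B :: "('i \<Rightarrow> 'k::field alg_closure) \<Rightarrow> 'i \<Rightarrow> 'k alg_closure" +
  fixes E :: "('i \<Rightarrow> 'k) set" and \<beta> :: "('i \<Rightarrow> 'k) \<Rightarrow> 'i \<Rightarrow> 'k"
  assumes B_to_ac: "B (to_ac \<circ> v) = to_ac \<circ> \<beta> v"
    and invariant: "v \<in> E \<Longrightarrow> \<beta> v \<in> E"
begin

lemma B_pow_to_ac: "(B ^^ j) (to_ac \<circ> v) = to_ac \<circ> (\<beta> ^^ j) v"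
proof (induction j)
  case (Suc j)
  have "(B ^^ Suc j) (to_ac \<circ> v) = B ((B ^^ j) (to_ac \<circ> v))" by simp
  also have "\<dots> = to_ac \<circ> \<beta> ((\<beta> ^^ j) v)" by (simp only: Suc B_to_ac)
  also have "\<beta> ((\<beta> ^^ j) v) = (\<beta> ^^ Suc j) v" by simp
  finally show ?case .
qed simp

text \<open>By linearity every representation of \<open>w\<close> as a combination of vectors from
  \<open>E\<close> leads to the value \<open>B w\<close>, so the description has exactly one
  solution. Injectivity of \<open>to_ac\<close> lets the coefficients from the span be indexed by
  vectors of \<open>E\<close>.\<close>

lemma extend_endo_eq:
  assumes "w \<in> extend_scalars E"
  shows "extend_endo E \<beta> w = B w"
proof -
  have B: "B (\<Sum>v\<in>F. fscale (a v) (to_ac \<circ> v)) = (\<Sum>v\<in>F. fscale (a v) (to_ac \<circ> \<beta> v))" for F a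
    by (simp only: sum scale B_to_ac)
  have inj: "inj_on (\<lambda>v. to_ac \<circ> v) A" for A :: "('i \<Rightarrow> 'k) set"
    by (intro inj_onI) (auto simp: fun_eq_iff comp_apply)
  obtain T r where T: "finite T" "T \<subseteq> (\<lambda>v. to_ac \<circ> v) ` E" "w = (\<Sum>x\<in>T. fscale (r x) x)"
    using assms unfolding extend_scalars_def fun_space.span_explicit by auto
  obtain F where F: "F \<subseteq> E" "finite F" "T = (\<lambda>v. to_ac \<circ> v) ` F"
    using finite_subset_image[OF T(1,2)] by blast
  have w: "w = (\<Sum>v\<in>F. fscale (r (to_ac \<circ> v)) (to_ac \<circ> v))"
    unfolding T(3) F(3) by (subst sum.reindex[OF inj]) (rule sum.cong, auto simp: comp_apply[of "\<lambda>x. fscale (r x) x"] simp del: comp_apply)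
  show ?thesis
    unfolding extend_endo_def
  proof (rule the_equality)
    show "\<exists>F a. finite F \<and> F \<subseteq> E \<and> w = (\<Sum>v\<in>F. fscale (a v) (to_ac \<circ> v)) \<and>
        B w = (\<Sum>v\<in>F. fscale (a v) (to_ac \<circ> \<beta> v))"
      using F w B by (intro exI[of _ F] exI[of _ "\<lambda>v. r (to_ac \<circ> v)"]) simp
  qed (use B in auto)
qed

lemma B_extend_scalars:
  assumes "w \<in> extend_scalars E"
  shows "B w \<in> extend_scalars E"
  using assms unfolding extend_scalars_def
proof (induction rule: fun_space.span_induct_alt)
  case base
  then show ?case by (simp add: fun_space.span_zero)
next
  case (step c x y)
  then obtain v where v: "x = to_ac \<circ> v" "v \<in> E" by blast
  have "to_ac \<circ> \<beta> v \<in> fun_space.span ((\<lambda>v. to_ac \<circ> v) ` E)"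
    using invariant[OF v(2)] by (intro fun_space.span_base imageI)
  then show ?case using step
    by (simp add: add scale v B_to_ac fun_space.span_add fun_space.span_scale del: comp_apply)
qed

lemma generalized_eigenspace_annihilated:
  assumes "w \<in> generalized_eigenspace E \<beta> \<mu>"
  shows "\<exists>n. poly_op ([:- \<mu>, 1:] ^ n) w = 0"
proof -
  obtain n where w: "w \<in> extend_scalars E"
    and n: "((\<lambda>u. extend_endo E \<beta> u - fscale \<mu> u) ^^ n) w = 0"
    using assms by (auto simp: generalized_eigenspace_def)
  define D where "D = (\<lambda>u. extend_endo E \<beta> u - fscale \<mu> u)"
  \<comment> \<open>Membership in \<open>extend_scalars E\<close> is part of the induction, as
    \<open>extend_endo\<close> is known to agree with \<open>B\<close> only there.\<close>
  have "(D ^^ k) w = poly_op ([:- \<mu>, 1:] ^ k) w \<and>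
      poly_op ([:- \<mu>, 1:] ^ k) w \<in> extend_scalars E" for k
  proof (induction k)
    case 0
    then show ?case using w by simp
  next
    case (Suc k)
    let ?u = "poly_op ([:- \<mu>, 1:] ^ k) w"
    have u: "?u \<in> extend_scalars E" using Suc by simp
    have "B ?u - fscale \<mu> ?u \<in> extend_scalars E"
      using B_extend_scalars[OF u] u unfolding extend_scalars_def
      by (intro fun_space.span_diff fun_space.span_scale)
    moreover have "D ?u = B ?u - fscale \<mu> ?u"
      unfolding D_def by (simp only: extend_endo_eq[OF u])
    moreover have "poly_op ([:- \<mu>, 1:] ^ Suc k) w = B ?u - fscale \<mu> ?u"
      by (simp only: power_Suc poly_op_mult poly_op_linear)
    ultimately show ?case
      using Suc by (simp only: funpow.simps comp_apply simp_thms)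
  qed
  with n show ?thesis unfolding D_def by metis
qed

text \<open>The predicate \<open>Q\<close> transports information on the eigenvalues to the annihilating polynomials.\<close>

context
  fixes Q :: "'k alg_closure poly \<Rightarrow> bool" and U :: "'k alg_closure set"
  assumes Q_1: "Q 1" and Q_mult: "\<And>p q. Q p \<Longrightarrow> Q q \<Longrightarrow> Q (p * q)"
    and Q_linear: "\<And>\<mu>. \<mu> \<in> U \<Longrightarrow> Q [:- \<mu>, 1:]"
begin

text \<open>Polynomials in \<open>B\<close> commute, so the product of annihilators of two vectors
  annihilates every combination of them.\<close>

lemma span_annihilated:
  assumes "\<And>w. w \<in> W \<Longrightarrow> \<exists>p. Q p \<and> poly_op p w = 0"
    and "w \<in> fun_space.span W"
  shows "\<exists>p. Q p \<and> poly_op p w = 0"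
  using assms(2)
proof (induction rule: fun_space.span_induct_alt)
  case base
  show ?case using Q_1 by auto
next
  case (step c x y)
  obtain p q where pq: "Q p" "poly_op p x = 0" "Q q" "poly_op q y = 0"
    using step assms(1) by blast
  have "poly_op (p * q) y = 0" by (simp add: poly_op_mult pq)
  moreover have "poly_op (q * p) x = 0" by (simp add: poly_op_mult pq)
  ultimately have "poly_op (p * q) (fscale c x + y) = 0"
    by (simp add: poly_op_add poly_op_scale mult.commute fscale_simps)
  then show ?case using Q_mult[OF pq(1,3)] by blast
qed

lemma generalized_eigenspaces_span_annihilated:
  assumes "w \<in> fun_space.span (\<Union>\<mu>\<in>U. generalized_eigenspace E \<beta> \<mu>)"
  shows "\<exists>p. Q p \<and> poly_op p w = 0"
proof (rule span_annihilated[OF _ assms])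
  fix w assume "w \<in> (\<Union>\<mu>\<in>U. generalized_eigenspace E \<beta> \<mu>)"
  then obtain \<mu> n where "\<mu> \<in> U" "poly_op ([:- \<mu>, 1:] ^ n) w = 0"
    using generalized_eigenspace_annihilated by blast
  moreover have "Q ([:- \<mu>, 1:] ^ n)"
    by (induction n) (auto simp: Q_1 intro!: Q_mult Q_linear \<open>\<mu> \<in> U\<close> simp del: mult_pCons_left)
  ultimately show "\<exists>p. Q p \<and> poly_op p w = 0" by blast
qed

lemma finite_annihilated:
  assumes "finite F" and "\<And>v. v \<in> F \<Longrightarrow> \<exists>p. Q p \<and> poly_op p (to_ac \<circ> v) = 0"
  shows "\<exists>p. Q p \<and> (\<forall>v\<in>F. poly_op p (to_ac \<circ> v) = 0)"
  using assms
proof (induction F)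
  case empty
  then show ?case using Q_1 by auto
next
  case (insert v F)
  then obtain p q where "Q p" "poly_op p (to_ac \<circ> v) = 0"
    and "Q q" "\<forall>v\<in>F. poly_op q (to_ac \<circ> v) = 0"
    by (metis insertCI)
  then have "Q (p * q)" "\<forall>u\<in>insert v F. poly_op (p * q) (to_ac \<circ> u) = 0"
    by (auto simp: poly_op_mult Q_mult) (metis mult.commute poly_op_0 poly_op_mult)
  then show ?case by blast
qed

end

end

text \<open>Splitting \<open>v\<close> into components from the \<open>\<beta>\<close>-invariant
  spaces \<open>Es \<rho>\<close> gives this, without a look at how tangent maps act on compatible
  families.\<close>

lemma characteristic_subspaces_invariant:
  assumes Es: "characteristic_subspaces avc E \<beta> Es" and "fun_endo \<beta>"
    and E: "fun_space.subspace E" and v: "v \<in> E"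
  shows "\<beta> v \<in> E"
proof -
  interpret fun_endo \<beta> by fact
  define R where "R = characteristic_values avc E \<beta>"
  note Es' = Es[unfolded characteristic_subspaces_def Let_def, folded R_def]
  have inv: "Es \<rho> \<subseteq> E \<and> \<beta> ` Es \<rho> \<subseteq> Es \<rho>" if "\<rho> \<in> R" for \<rho>
    using Es'[THEN conjunct1, THEN bspec, OF that] by (elim conjE, intro conjI)
  obtain f where f: "\<forall>\<rho>\<in>R. f \<rho> \<in> Es \<rho>" "v = (\<Sum>\<rho>\<in>R. f \<rho>)"
    using Es'[THEN conjunct2, THEN conjunct2, THEN bspec, OF v] by (elim ex1E conjE)
  have "\<beta> v = (\<Sum>\<rho>\<in>R. \<beta> (f \<rho>))" by (simp add: f(2) sum)
  moreover have "\<beta> (f \<rho>) \<in> E" if "\<rho> \<in> R" for \<rho>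
    using inv[OF that] f(1) that by blast
  ultimately show ?thesis using E by (simp add: fun_space.subspace_sum)
qed

text \<open>After extension of scalars, \<open>Es \<rho>\<close> is spanned by the generalized
  eigenspaces with \<open>avc \<mu> = \<rho>\<close>, whose vectors are killed by powers of
  \<open>[:- \<mu>, 1:]\<close>. The index set may contain values that are not characteristic; there
  \<open>Es \<rho>\<close> is zero and the polynomial 1 serves.\<close>

lemma sum_of_subspaces_annihilated:
  assumes Es: "characteristic_subspaces avc E \<beta> Es"
    and B: "extended_endo B E \<beta>"
    and "Q 1" "\<And>p q. Q p \<Longrightarrow> Q q \<Longrightarrow> Q (p * q)" "\<And>\<mu>. avc \<mu> \<in> I \<Longrightarrow> Q [:- \<mu>, 1:]"
    and v: "v \<in> sum_of_subspaces I Es"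
  shows "\<exists>p. Q p \<and> fun_endo.poly_op B p (to_ac \<circ> v) = 0"
proof -
  interpret extended_endo B E \<beta> by fact
  note Es' = Es[unfolded characteristic_subspaces_def Let_def]
  let ?P = "\<lambda>w. \<exists>p. Q p \<and> poly_op p w = 0"
  have base: "?P (to_ac \<circ> v)" if "\<rho> \<in> I" "v \<in> Es \<rho>" for \<rho> v
  proof (cases "\<rho> \<in> characteristic_values avc E \<beta>")
    case True
    then have "extend_scalars (Es \<rho>) =
        fun_space.span (\<Union>\<mu>\<in>{\<mu>. avc \<mu> = \<rho>}. generalized_eigenspace E \<beta> \<mu>)"
      using Es'[THEN conjunct1, THEN bspec, OF True] by (elim conjE)
    moreover have "to_ac \<circ> v \<in> extend_scalars (Es \<rho>)"
      unfolding extend_scalars_def using that by (intro fun_space.span_base imageI)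
    ultimately show ?thesis
      using assms(3-5) that(1)
      by (intro generalized_eigenspaces_span_annihilated[of Q "{\<mu>. avc \<mu> = \<rho>}"]) auto
  next
    case False
    then have "v = 0" using Es'[THEN conjunct2, THEN conjunct1] that by auto
    then show ?thesis using assms(3) by (intro exI[of _ 1]) (simp add: to_ac_comp_simps)
  qed
  have "to_ac \<circ> v \<in> fun_space.span ((\<lambda>v. to_ac \<circ> v) ` (\<Union>\<rho>\<in>I. Es \<rho>))"
    using v unfolding sum_of_subspaces_def
  proof (induction rule: fun_space.span_induct_alt)
    case base
    then show ?case by (simp add: to_ac_comp_simps fun_space.span_zero)
  next
    case (step c x y)
    then show ?case
      by (simp only: to_ac_comp_simps)
        (rule fun_space.span_add[OF fun_space.span_scale[OF fun_space.span_base[OF imageI]]], assumption+)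
  qed
  then show ?thesis
    using assms(3-5) base by (elim span_annihilated[of Q "{\<mu>. avc \<mu> \<in> I}", rotated -1]) auto
qed

section \<open>Tangent spaces in charts\<close>

lemma is_chart_inj:
  assumes "is_chart T m c"
  shows "inj_on (snd c) (fst c)"
proof -
  have "homeomorphic_map (subtopology T (fst c)) (top_of_set (snd c ` fst c)) (snd c)"
    and sub: "fst c \<subseteq> topspace T"
    using assms openin_subset by (auto simp: is_chart_def)
  from homeomorphic_imp_injective_map[OF this(1)] show ?thesis
    using sub by (simp add: inf_absorb2)
qed

lemma is_chart_coord_space:
  assumes "is_chart T m c"
  shows "snd c ` fst c \<subseteq> coord_space m"
  using assms openin_subset[of "top_of_set (coord_space m)" "snd c ` fst c"]
  by (simp add: is_chart_def)

lemma in_charts_apply: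
  assumes "inj_on (snd c) (fst c)" "x \<in> fst c"
  shows "in_charts f c c' (snd c x) = snd c' (f x)"
  using assms by (simp add: in_charts_def)

lemma manifold_chart:
  assumes "analytic_manifold M" "c \<in> atlas M"
  shows "is_chart (mtop M) (mdim M) c"
  using assms unfolding analytic_manifold_def complete_atlas_def by blast

lemma manifold_compatible:
  assumes "analytic_manifold M" "c \<in> atlas M" "c' \<in> atlas M"
  shows "compatible_charts (mdim M) c c'"
  using assms unfolding analytic_manifold_def complete_atlas_def by blast

lemma compatible_charts_sym: "compatible_charts m c c' \<longleftrightarrow> compatible_charts m c' c"
  by (auto simp: compatible_charts_def Int_commute)

text \<open>The chart that \<open>induced_structure\<close> makes from an adapted chart; restricting
  the coordinate map keeps it extensional, as \<open>is_chart\<close> demands.\<close>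

definition restrict_chart :: "'g set \<Rightarrow> ('g, 'k) chart \<Rightarrow> ('g, 'k) chart" where
  "restrict_chart N c = (fst c \<inter> N, restrict (snd c) (fst c \<inter> N))"

lemma fst_restrict_chart [simp]: "fst (restrict_chart N c) = fst c \<inter> N"
  by (simp add: restrict_chart_def)

lemma snd_restrict_chart [simp]: "x \<in> fst c \<Longrightarrow> x \<in> N \<Longrightarrow> snd (restrict_chart N c) x = snd c x"
  by (simp add: restrict_chart_def)

lemma image_restrict_chart:
  "A \<subseteq> fst c \<inter> N \<Longrightarrow> snd (restrict_chart N c) ` A = snd c ` A"
  by (rule image_cong) (auto intro!: snd_restrict_chart)

lemma adapted_chart_mem:
  assumes M: "analytic_manifold M" and c: "c \<in> adapted_charts M d N" and x: "x \<in> fst c"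
  shows "snd c x \<in> coord_space d \<longleftrightarrow> x \<in> N"
proof -
  have atl: "c \<in> atlas M" and eq: "snd c ` (fst c \<inter> N) = snd c ` fst c \<inter> coord_space d"
    using c by (auto simp: adapted_charts_def)
  have inj: "inj_on (snd c) (fst c)"
    using is_chart_inj[OF manifold_chart[OF M atl]] .
  show ?thesis
  proof
    assume "snd c x \<in> coord_space d"
    then have "snd c x \<in> snd c ` (fst c \<inter> N)" using x eq by blast
    then show "x \<in> N" using inj x by (auto dest: inj_onD)
  next
    assume "x \<in> N"
    then show "snd c x \<in> coord_space d" using x eq by blast
  qed
qed

lemma openin_coord_space_Int:
  assumes "openin (top_of_set (coord_space m)) V" "d \<le> m"
  shows "openin (top_of_set (coord_space d)) (V \<inter> coord_space d)"
proof -
  obtain T where T: "open T" "V = coord_space m \<inter> T"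
    using assms(1) by (auto simp: openin_open)
  have "V \<inter> coord_space d = coord_space d \<inter> T"
    using T(2) assms(2) by (auto simp: coord_space_def)
  then show ?thesis using T(1) by (simp add: openin_open_Int)
qed

lemma restrict_chart_is_chart:
  assumes M: "analytic_manifold M" and N: "submanifold M d N" and c: "c \<in> adapted_charts M d N"
  shows "is_chart (subtopology (mtop M) N) d (restrict_chart N c)"
proof -
  have atl: "c \<in> atlas M" and eq: "snd c ` (fst c \<inter> N) = snd c ` fst c \<inter> coord_space d"
    using c by (auto simp: adapted_charts_def)
  have d: "d \<le> mdim M" using N by (simp add: submanifold_def)
  have ch: "is_chart (mtop M) (mdim M) c" using manifold_chart[OF M atl] .
  then have op: "openin (mtop M) (fst c)"
    and hom: "homeomorphic_map (subtopology (mtop M) (fst c)) (top_of_set (snd c ` fst c)) (snd c)"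
    and img: "openin (top_of_set (coord_space (mdim M))) (snd c ` fst c)"
    by (auto simp: is_chart_def)
  have sub: "fst c \<subseteq> topspace (mtop M)" using op openin_subset by blast
  have image: "snd (restrict_chart N c) ` (fst c \<inter> N) = snd c ` (fst c \<inter> N)"
    by (rule image_restrict_chart) simp
  have "homeomorphic_map (subtopology (subtopology (mtop M) (fst c)) N)
      (subtopology (top_of_set (snd c ` fst c)) (snd c ` (fst c \<inter> N))) (snd c)"
    using sub by (intro homeomorphic_map_subtopologies[OF hom]) (auto simp: inf_absorb2)
  then have "homeomorphic_map (subtopology (mtop M) (fst c \<inter> N))
      (top_of_set (snd c ` (fst c \<inter> N))) (snd c)"
    by (simp add: subtopology_subtopology inf_absorb2 image_mono)
  then have "homeomorphic_map (subtopology (mtop M) (fst c \<inter> N))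
      (top_of_set (snd c ` (fst c \<inter> N))) (snd (restrict_chart N c))"
    by (rule homeomorphic_map_eq) auto
  moreover have "subtopology (subtopology (mtop M) N) (fst c \<inter> N) = subtopology (mtop M) (fst c \<inter> N)"
    by (simp add: subtopology_subtopology inf_absorb2)
  moreover have "openin (subtopology (mtop M) N) (fst c \<inter> N)"
    using op by (rule openin_subtopology_Int)
  moreover have "openin (top_of_set (coord_space d)) (snd c ` (fst c \<inter> N))"
    unfolding eq using openin_coord_space_Int[OF img d] .
  moreover have "snd (restrict_chart N c) \<in> extensional (fst c \<inter> N)"
    by (simp add: restrict_chart_def)
  ultimately show ?thesis
    unfolding is_chart_def fst_restrict_chart image by auto
qed

lemma induced_structure_simps:
  "mtop (induced_structure M d N) = subtopology (mtop M) N"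
  "mdim (induced_structure M d N) = d"
  "atlas (induced_structure M d N) = complete_atlas (subtopology (mtop M) N) d
     (restrict_chart N ` adapted_charts M d N)"
  by (simp_all add: induced_structure_def restrict_chart_def)

context local_value
begin

lemma vnorm_coord_space_mono:
  assumes "h \<in> coord_space d" "d \<le> m"
  shows "vnorm m h = vnorm d h"
proof (rule antisym)
  show "vnorm d h \<le> vnorm m h" using assms by (auto simp: vnorm_le_iff intro: le_vnorm)
  have "av (h i) \<le> vnorm d h" for i
    using assms le_vnorm[of i d h] by (cases "i < d") (auto simp: coord_space_def)
  then show "vnorm m h \<le> vnorm d h" by (auto simp: vnorm_le_iff)
qed

text \<open>Setting the variables from index \<open>d\<close> on to 0 kills the monomials that
  involve them, so the same coefficients serve in fewer variables.\<close>

lemma power_series_analytic_at_restrict: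
  fixes x :: "nat \<Rightarrow> 'a"
  assumes f: "power_series_analytic_at m f x" and d: "d \<le> m"
    and U: "openin (top_of_set (coord_space d)) U" "x \<in> U" and g: "\<And>y. y \<in> U \<Longrightarrow> g y = f y"
  shows "power_series_analytic_at d g x"
proof -
  obtain c V where V: "openin (top_of_set (coord_space m)) V" "0 \<in> V"
    and sums: "\<And>h. h \<in> V \<Longrightarrow>
      ((\<lambda>a. c a * (\<Prod>i<m. h i ^ a i)) has_sum f (x + h)) (multi_indices m)"
    using f unfolding power_series_analytic_at_def plus_fun_def zero_fun_def by blast
  obtain d0 where d0: "d0 > 0" "\<And>h. h \<in> coord_space m \<Longrightarrow> vnorm m h < d0 \<Longrightarrow> h \<in> V"
    using openin_coord_spaceD[OF V] by auto
  obtain d1 where d1: "d1 > 0" "\<And>h. h \<in> coord_space d \<Longrightarrow> vnorm d h < d1 \<Longrightarrow> x + h \<in> U"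
    using openin_coord_spaceD[OF U] by auto
  let ?V = "{h \<in> coord_space d. vnorm d (h - 0) < min d0 d1}"
  have "((\<lambda>a. c a * (\<Prod>i<d. h i ^ a i)) has_sum g (\<lambda>i. x i + h i)) (multi_indices d)"
    if "h \<in> ?V" for h
  proof -
    have h: "h \<in> coord_space d" "vnorm d h < d0" "vnorm d h < d1" using that by auto
    have "h \<in> coord_space m" using h(1) d by (auto simp: coord_space_def)
    then have "h \<in> V" using h by (intro d0(2)) (simp_all add: vnorm_coord_space_mono[OF h(1) d])
    note s = sums[OF this]
    have "((\<lambda>a. c a * (\<Prod>i<d. h i ^ a i)) has_sum f (x + h)) (multi_indices d) \<longleftrightarrow>
        ((\<lambda>a. c a * (\<Prod>i<m. h i ^ a i)) has_sum f (x + h)) (multi_indices m)"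
    proof (rule has_sum_cong_neutral)
      fix a assume a: "a \<in> multi_indices m - multi_indices d"
      then obtain i where i: "i \<ge> d" "a i \<noteq> 0" by (auto simp: multi_indices_def)
      then have "i < m" using a multi_indices_support by auto
      moreover have "h i = 0" using i h(1) by (auto simp: coord_space_def)
      ultimately have "(\<Prod>i<m. h i ^ a i) = 0"
        using i by (intro prod_zero) auto
      then show "c a * (\<Prod>i<m. h i ^ a i) = 0" by (simp only: mult_zero_right)
    next
      fix a assume a: "a \<in> multi_indices d \<inter> multi_indices m"
      have "(\<Prod>i<d. h i ^ a i) = (\<Prod>i<m. h i ^ a i)"
        using a d by (intro prod.mono_neutral_left) (auto simp: multi_indices_def)
      then show "c a * (\<Prod>i<d. h i ^ a i) = c a * (\<Prod>i<m. h i ^ a i)" by simp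
    qed (use d in \<open>auto simp: multi_indices_def\<close>)
    then show ?thesis using s g[OF d1(2)[OF h(1,3)]] by (simp add: plus_fun_def)
  qed
  moreover have "openin (top_of_set (coord_space d)) ?V" by (rule openin_vnorm_ball)
  moreover have "(\<lambda>_. 0) \<in> ?V"
    using d0 d1 by (simp add: coord_space_def zero_fun_apply flip: zero_fun_def)
  ultimately show ?thesis unfolding power_series_analytic_at_def by blast
qed

lemma analytic_between_has_jacobian:
  fixes F :: "(nat \<Rightarrow> 'a) \<Rightarrow> nat \<Rightarrow> 'a"
  assumes "analytic_between m n U F" "x \<in> U"
  shows "\<exists>a. has_jacobian m n F a x"
  using assms by (intro analytic_has_jacobian) (auto simp: analytic_between_def)

section \<open>Transitions, the chain rule in charts, and tangent vectors of submanifolds\<close>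

lemma has_jacobian_inclusion:
  assumes U: "openin (top_of_set (coord_space m)) U" "x \<in> U"
    and F: "\<And>y i. y \<in> U \<Longrightarrow> i < n \<Longrightarrow> F y i = y i"
  shows "has_jacobian m n F (\<lambda>i j. if i = j then 1 else 0) x"
  unfolding has_jacobian_def
proof (intro allI impI)
  fix e :: real assume e: "e > 0"
  obtain d where d: "d > 0" "\<And>h. h \<in> coord_space m \<Longrightarrow> vnorm m h < d \<Longrightarrow> x + h \<in> U"
    using openin_coord_spaceD[OF U] by auto
  have "av (F (x + h) i - F x i - (\<Sum>j<m. (if i = j then 1 else 0) * h j)) \<le> e * vnorm m h"
    if h: "h \<in> coord_space m" "vnorm m h < d" and i: "i < n" for h i
  proof -
    have "(\<Sum>j<m. (if i = j then 1 else 0) * h j) = (\<Sum>j<m. if i = j then h j else 0)"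
      by (intro sum.cong) auto
    also have "\<dots> = h i" using h(1) by (auto simp: coord_space_def)
    finally show ?thesis
      using F[OF d(2)[OF h] i] F[OF U(2) i] e by (simp add: plus_fun_apply)
  qed
  with d(1) show "\<exists>d>0. \<forall>h\<in>coord_space m. vnorm m h < d \<longrightarrow>
      (\<forall>i<n. av (F (x + h) i - F x i - (\<Sum>j<m. (if i = j then 1 else 0) * h j)) \<le> e * vnorm m h)"
    by blast
qed

text \<open>Vectors are zero-padded sequences, so the inclusion of K^m into K^n is literally the
  identity. Both the identity transition of a chart and the passage from a submanifold chart to its
  ambient chart are of this kind.\<close>

lemma differential_inclusion:
  fixes F :: "(nat \<Rightarrow> 'a) \<Rightarrow> nat \<Rightarrow> 'a"
  assumes "openin (top_of_set (coord_space m)) U" "x \<in> U"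
    and "\<And>y i. y \<in> U \<Longrightarrow> i < n \<Longrightarrow> F y i = y i"
    and h: "h \<in> coord_space m" and "m \<le> n"
  shows "differential m n F x h = h"
proof
  fix i
  have "has_jacobian m n F (\<lambda>i j. if i = j then 1 else 0) x"
    by (rule has_jacobian_inclusion[OF assms(1,2)]) (rule assms(3))
  note jac = has_jacobian_differential[OF this]
  have "(\<Sum>j<m. (if i = j then 1 else 0) * h j) = (\<Sum>j<m. if i = j then h j else 0)"
    by (intro sum.cong) auto
  also have "\<dots> = h i" using h(1) by (auto simp: coord_space_def)
  finally show "differential m n F x h i = h i"
    using h \<open>m \<le> n\<close> by (auto simp: jac coord_space_def)
qed

text \<open>The chain rule through charts. Three dimensions and two maps are allowed so that it
  covers transitions, the inclusion of a submanifold chart, and \<open>\<alpha>\<close> preceded by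
  a transition.\<close>

lemma in_charts_compose:
  assumes F: "\<exists>a. has_jacobian m n (in_charts f c c1) a (snd c p)"
    and G: "\<exists>b. has_jacobian n k (in_charts g c1 c2) b (snd c1 (f p))"
    and inj: "inj_on (snd c) (fst c)" "inj_on (snd c1) (fst c1)"
    and U: "openin (top_of_set (coord_space m)) (snd c ` U)" "U \<subseteq> fst c" "p \<in> U"
    and fU: "f ` U \<subseteq> fst c1" and c1: "snd c1 ` fst c1 \<subseteq> coord_space n"
    and e: "\<And>x. x \<in> U \<Longrightarrow> e x = g (f x)"
  shows "\<exists>a. has_jacobian m k (in_charts e c c2) a (snd c p)" (is ?jac)
    and "differential m k (in_charts e c c2) (snd c p) h =
      differential n k (in_charts g c1 c2) (snd c1 (f p))
        (differential m n (in_charts f c c1) (snd c p) h)" (is ?diff)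
proof -
  obtain a b where a: "has_jacobian m n (in_charts f c c1) a (snd c p)"
    and b: "has_jacobian n k (in_charts g c1 c2) b (snd c1 (f p))"
    using F G by blast
  have in_c: "x \<in> fst c" "f x \<in> fst c1" if "x \<in> U" for x
    using that U(2) fU by auto
  have Fx: "in_charts f c c1 (snd c x) = snd c1 (f x)" if "x \<in> U" for x
    using in_charts_apply[OF inj(1) in_c(1)[OF that]] .
  have "has_jacobian m k (in_charts e c c2) (\<lambda>i l. \<Sum>j<n. b i j * a j l) (snd c p)"
  proof (rule has_jacobian_compose[OF a _ U(1)])
    show "has_jacobian n k (in_charts g c1 c2) b (in_charts f c c1 (snd c p))"
      using b Fx[OF U(3)] by simp
    show "snd c p \<in> snd c ` U" using U(3) by blast
    show "in_charts f c c1 ` snd c ` U \<subseteq> coord_space n"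
      using Fx in_c(2) c1 by (auto simp: image_subset_iff)
    fix y i assume "y \<in> snd c ` U" "i < k"
    then obtain x where x: "x \<in> U" "y = snd c x" by blast
    have "in_charts e c c2 y = in_charts g c1 c2 (in_charts f c c1 y)"
      unfolding x(2) Fx[OF x(1)] in_charts_apply[OF inj(2) in_c(2)[OF x(1)]]
        in_charts_apply[OF inj(1) in_c(1)[OF x(1)]] e[OF x(1)] ..
    then show "in_charts e c c2 y i = in_charts g c1 c2 (in_charts f c c1 y) i" by simp
  qed
  note ba = this
  then show ?jac by blast
  show ?diff
    unfolding has_jacobian_differential[OF ba] has_jacobian_differential[OF a]
      has_jacobian_differential[OF b]
    by (rule ext)
      (simp add: sum_distrib_left sum_distrib_right mult.assoc, intro impI, rule sum.swap)
qed

lemma in_charts_id_compose: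
  assumes "\<exists>a. has_jacobian m n (in_charts id c c') a (snd c p)"
    and "\<exists>b. has_jacobian n k (in_charts id c' c'') b (snd c' p)"
    and "is_chart T m c" "is_chart T' n c'"
    and "openin (top_of_set (coord_space m)) (snd c ` (fst c \<inter> fst c'))" "p \<in> fst c" "p \<in> fst c'"
  shows "\<exists>a. has_jacobian m k (in_charts id c c'') a (snd c p)"
    and "differential m k (in_charts id c c'') (snd c p) h =
      differential n k (in_charts id c' c'') (snd c' p) (differential m n (in_charts id c c') (snd c p) h)"
proof -
  have "\<exists>b. has_jacobian n k (in_charts id c' c'') b (snd c' (id p))"
    using assms(2) by simp
  note comp = in_charts_compose[OF assms(1) this is_chart_inj[OF assms(3)] is_chart_inj[OF assms(4)] assms(5)]
  show "\<exists>a. has_jacobian m k (in_charts id c c'') a (snd c p)"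
    by (rule comp(1)) (use assms is_chart_coord_space[OF assms(4)] in auto)
  have "differential m k (in_charts id c c'') (snd c p) h =
      differential n k (in_charts id c' c'') (snd c' (id p)) (differential m n (in_charts id c c') (snd c p) h)"
    by (rule comp(2)) (use assms is_chart_coord_space[OF assms(4)] in auto)
  then show "differential m k (in_charts id c c'') (snd c p) h =
      differential n k (in_charts id c' c'') (snd c' p) (differential m n (in_charts id c c') (snd c p) h)"
    by (simp only: id_apply)
qed

lemma compatible_charts_jacobian:
  fixes c :: "('g, 'a) chart"
  assumes "compatible_charts m c c'" "p \<in> fst c" "p \<in> fst c'"
  shows "\<exists>a. has_jacobian m m (in_charts id c c') a (snd c p)"
    and "openin (top_of_set (coord_space m)) (snd c ` (fst c \<inter> fst c'))"
  using assms analytic_between_has_jacobian[of m m "snd c ` (fst c \<inter> fst c')" "in_charts id c c'"]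
  unfolding compatible_charts_def by (auto simp: analytic_between_def)

text \<open>A completed atlas consists of charts compatible with all generating charts, so the
  restricted charts belong to it only once they are compatible with each other.\<close>

lemma restrict_chart_compatible:
  fixes M :: "('g, 'a) analytic_structure"
  assumes M: "analytic_manifold M" and N: "submanifold M d N"
    and c: "c \<in> adapted_charts M d N" "c' \<in> adapted_charts M d N"
  shows "compatible_charts d (restrict_chart N c) (restrict_chart N c')"
proof -
  have d: "d \<le> mdim M" using N by (simp add: submanifold_def)
  have "analytic_between d d (snd (restrict_chart N c) ` (fst (restrict_chart N c) \<inter> fst (restrict_chart N c')))
      (in_charts id (restrict_chart N c) (restrict_chart N c'))"
    if c: "c \<in> adapted_charts M d N" "c' \<in> adapted_charts M d N" for c c'
  proof -
    let ?m = "mdim M" and ?U = "fst c \<inter> fst c' \<inter> N"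
    let ?f = "in_charts id c c'" and ?g = "in_charts id (restrict_chart N c) (restrict_chart N c')"
    have atl: "c \<in> atlas M" "c' \<in> atlas M" using c by (auto simp: adapted_charts_def)
    have inj: "inj_on (snd c) (fst c)"
      using is_chart_inj[OF manifold_chart[OF M atl(1)]] .
    have inj': "inj_on (snd (restrict_chart N c)) (fst (restrict_chart N c))"
      using is_chart_inj[OF restrict_chart_is_chart[OF M N c(1)]] .
    have ana: "analytic_between ?m ?m (snd c ` (fst c \<inter> fst c')) ?f"
      using manifold_compatible[OF M atl] by (simp add: compatible_charts_def)
    have dom: "fst (restrict_chart N c) \<inter> fst (restrict_chart N c') = ?U" by auto
    have img: "snd (restrict_chart N c) ` ?U = snd c ` ?U"
      by (rule image_restrict_chart) auto
    have "snd c ` ?U = snd c ` (fst c \<inter> fst c') \<inter> coord_space d"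
      using adapted_chart_mem[OF M c(1)] by auto
    then have op: "openin (top_of_set (coord_space d)) (snd c ` ?U)"
      using openin_coord_space_Int[OF _ d, of "snd c ` (fst c \<inter> fst c')"] ana
      by (simp add: analytic_between_def)
    have f: "?f (snd c x) = snd c' x" if "x \<in> ?U" for x
      using in_charts_apply[OF inj, of x id c'] that by simp
    have g: "?g (snd c x) = snd c' x" if "x \<in> ?U" for x
      using in_charts_apply[OF inj', of x id "restrict_chart N c'"] that by simp
    have "?g ` snd c ` ?U \<subseteq> coord_space d"
      using g adapted_chart_mem[OF M c(2)] by (auto simp: image_subset_iff)
    moreover have "power_series_analytic_at d (\<lambda>y. ?g y i) (snd c x)" if "x \<in> ?U" "i < d" for x i
    proof (rule power_series_analytic_at_restrict[OF _ d op])
      show "power_series_analytic_at ?m (\<lambda>y. ?f y i) (snd c x)"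
        using ana that d by (auto simp: analytic_between_def)
      show "snd c x \<in> snd c ` ?U" using that by blast
      show "?g y i = ?f y i" if "y \<in> snd c ` ?U" for y using that f g by auto
    qed
    ultimately show ?thesis
      unfolding dom img analytic_between_def using op by blast
  qed
  from this[OF c] this[OF c(2,1)] show ?thesis
    by (simp add: compatible_charts_def Int_commute)
qed

text \<open>Transporting \<open>h\<close> from the restricted chart \<open>c1\<close> along the
  differentials of the transitions gives a compatible family, and the map from \<open>c1\<close> to
  \<open>c\<close> is the inclusion of coordinate spaces, which leaves \<open>h\<close>
  unchanged.\<close>

lemma sub_tangent_space_coordinates:
  fixes M :: "('g, 'a) analytic_structure"
  assumes M: "analytic_manifold M" and N: "submanifold M d N"
    and c: "c \<in> adapted_charts M d N" and p: "p \<in> fst c" "p \<in> N" and h: "h \<in> coord_space d"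
  shows "\<exists>v\<in>sub_tangent_space M d N p. curry v c = h"
proof -
  define J where "J = induced_structure M d N"
  define c1 where "c1 = restrict_chart N c"
  note J = induced_structure_simps[of M d N, folded J_def]
  have d: "d \<le> mdim M" using N by (simp add: submanifold_def)
  have atl: "c \<in> atlas M" using c by (auto simp: adapted_charts_def)
  have c1: "is_chart (subtopology (mtop M) N) d c1"
    unfolding c1_def by (rule restrict_chart_is_chart[OF M N c])
  have p1: "p \<in> fst c1" using p by (simp add: c1_def)
  have "c1 \<in> atlas J"
    unfolding J complete_atlas_def c1_def
    using c restrict_chart_is_chart[OF M N c] restrict_chart_compatible[OF M N c] by blast
  then have c1J: "c1 \<in> charts_at J p" using p1 by (simp add: charts_at_def)
  have chJ: "is_chart (subtopology (mtop M) N) d c'" "compatible_charts d c' c1" "p \<in> fst c'"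
    if "c' \<in> charts_at J p" for c'
    using that c unfolding charts_at_def J complete_atlas_def c1_def by auto
  define D where "D c' c'' = differential d d (in_charts id c' c'') (snd c' p)"
    for c' c'' :: "('g, 'a) chart"
  have jac: "\<exists>a. has_jacobian d d (in_charts id c' c1) a (snd c' p)"
    "\<exists>a. has_jacobian d d (in_charts id c1 c') a (snd c1 p)"
    "openin (top_of_set (coord_space d)) (snd c' ` (fst c' \<inter> fst c1))"
    "openin (top_of_set (coord_space d)) (snd c1 ` (fst c1 \<inter> fst c'))"
    if "c' \<in> charts_at J p" for c'
    using compatible_charts_jacobian[OF chJ(2)[OF that] chJ(3)[OF that] p1]
      compatible_charts_jacobian[OF chJ(2)[OF that, unfolded compatible_charts_sym[of d c']] p1 chJ(3)[OF that]]
    by auto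
  \<comment> \<open>The charts \<open>c'\<close> and \<open>c''\<close> of the completed atlas are
    known to be compatible with \<open>c1\<close>, but not with each other, so their transition is
    differentiated through \<open>c1\<close>.\<close>
  have D1: "D c' c'' w = D c1 c'' (D c' c1 w)"
    if c': "c' \<in> charts_at J p" "c'' \<in> charts_at J p" for c' c'' w
    unfolding D_def
    by (rule in_charts_id_compose(2)[OF jac(1)[OF c'(1)] jac(2)[OF c'(2)] chJ(1)[OF c'(1)] c1
          jac(3)[OF c'(1)] chJ(3)[OF c'(1)] p1])
  have Dinv: "D c' c1 (D c1 c' w) = w" if c': "c' \<in> charts_at J p" "w \<in> coord_space d" for c' w
  proof -
    have "D c1 c1 w = D c' c1 (D c1 c' w)"
      unfolding D_def
      by (rule in_charts_id_compose(2)[OF jac(2)[OF c'(1)] jac(1)[OF c'(1)] c1 chJ(1)[OF c'(1)]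
            jac(4)[OF c'(1)] p1 chJ(3)[OF c'(1)]])
    moreover have "D c1 c1 w = w"
      unfolding D_def
    proof (rule differential_inclusion)
      show "openin (top_of_set (coord_space d)) (snd c1 ` (fst c1 \<inter> fst c1))"
        by (rule jac(3)[OF c1J])
      fix y i assume "y \<in> snd c1 ` (fst c1 \<inter> fst c1)"
      then show "in_charts id c1 c1 y i = y i"
        using in_charts_apply[OF is_chart_inj[OF c1], of _ id c1] by auto
    qed (use p1 c' in auto)
    ultimately show ?thesis by simp
  qed
  define v where "v = (\<lambda>(c', i). if c' \<in> charts_at J p then D c1 c' h i else 0)"
  have v: "curry v c' = D c1 c' h" if "c' \<in> charts_at J p" for c'
    using that by (auto simp: v_def fun_eq_iff)
  have "v \<in> tangent_space J p"
    unfolding tangent_space_def mem_Collect_eq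
  proof (intro conjI ballI allI impI)
    fix c' assume "c' \<in> charts_at J p"
    then show "curry v c' \<in> coord_space (mdim J)"
      by (simp add: v J D_def differential_def coord_space_def)
  next
    fix c' assume "c' \<notin> charts_at J p"
    then show "curry v c' = (\<lambda>_. 0)" by (auto simp: v_def fun_eq_iff)
  next
    fix c' c'' assume c': "c' \<in> charts_at J p" "c'' \<in> charts_at J p"
    show "curry v c'' = differential (mdim J) (mdim J) (in_charts id c' c'') (snd c' p) (curry v c')"
      using D1[OF c', of "D c1 c' h"] Dinv[OF c'(1) h] by (simp add: v[OF c'(1)] v[OF c'(2)] J D_def)
  qed
  then have w: "tangent_map J M id p v \<in> sub_tangent_space M d N p"
    by (simp add: sub_tangent_space_def J_def)
  \<comment> \<open>\<open>tangent_map\<close> evaluates in this arbitrary chart; the chain rule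
    carries the result back to \<open>c1\<close>.\<close>
  define c0 where "c0 = (SOME c. c \<in> charts_at J p)"
  have c0: "c0 \<in> charts_at J p" unfolding c0_def by (rule someI, rule c1J)
  have cM: "c \<in> charts_at M (id p)" using p atl by (simp add: charts_at_def)
  have coord1: "snd c1 x = snd c x" if "x \<in> fst c1" for x
    using that by (simp add: c1_def)
  have incl: "in_charts id c1 c y i = y i" if "y \<in> snd c1 ` fst c1" for y i
    using that in_charts_apply[OF is_chart_inj[OF c1], of _ id c] coord1 by auto
  have op1: "openin (top_of_set (coord_space d)) (snd c1 ` fst c1)"
    using jac(3)[OF c1J] by simp
  have jac1: "\<exists>a. has_jacobian d (mdim M) (in_charts id c1 c) a (snd c1 p)"
    by (rule exI, rule has_jacobian_inclusion[OF op1]) (use p1 incl in auto)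
  note jac0 = in_charts_id_compose(1)[OF jac(1)[OF c0] jac1 chJ(1)[OF c0] c1 jac(3)[OF c0] chJ(3)[OF c0] p1]
  have "differential d (mdim M) (in_charts id c1 c) (snd c1 p) h =
      differential d (mdim M) (in_charts id c0 c) (snd c0 p) (D c1 c0 h)"
    unfolding D_def
    by (rule in_charts_id_compose(2)[OF jac(2)[OF c0] jac0 c1 chJ(1)[OF c0] jac(4)[OF c0] p1 chJ(3)[OF c0]])
  moreover have "differential d (mdim M) (in_charts id c1 c) (snd c1 p) h = h"
    by (rule differential_inclusion[OF op1 _ _ h d]) (use p1 incl in auto)
  moreover have "curry (tangent_map J M id p v) c =
      differential d (mdim M) (in_charts id c0 c) (snd c0 p) (curry v c0)"
    using cM by (simp add: tangent_map_def Let_def J fun_eq_iff flip: c0_def)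
  ultimately have "curry (tangent_map J M id p v) c = h" by (simp add: v[OF c0])
  with w show ?thesis by blast
qed

text \<open>\<open>tangent_map\<close> works in an arbitrarily chosen chart \<open>c0\<close>. The
  compatibility of \<open>v\<close> and the chain rule for the transition from \<open>c\<close> to
  \<open>c0\<close> turn this into the derivative of \<open>\<alpha>\<close> in \<open>c\<close>, so
  that iterates of the tangent map become powers of one matrix.\<close>

lemma tangent_map_in_chart:
  fixes M :: "('g, 'a) analytic_structure"
  assumes M: "analytic_manifold M" and \<alpha>: "analytic_map M M \<alpha>" "\<alpha> p = p"
    and c: "c \<in> charts_at M p" and v: "v \<in> tangent_space M p"
  shows "curry (tangent_map M M \<alpha> p v) c =
    differential (mdim M) (mdim M) (in_charts \<alpha> c c) (snd c p) (curry v c)"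
proof -
  let ?m = "mdim M"
  define c0 where "c0 = (SOME c. c \<in> charts_at M p)"
  have c0: "c0 \<in> charts_at M p" unfolding c0_def by (rule someI, rule c)
  have atl: "c \<in> atlas M" "c0 \<in> atlas M" "p \<in> fst c" "p \<in> fst c0"
    using c c0 by (auto simp: charts_at_def)
  note ch = manifold_chart[OF M atl(1)] manifold_chart[OF M atl(2)]
  have "analytic_between ?m ?m (snd c0 ` {x \<in> fst c0. \<alpha> x \<in> fst c}) (in_charts \<alpha> c0 c)"
    using \<alpha>(1) atl by (auto simp: analytic_map_def)
  then have jac: "\<exists>a. has_jacobian ?m ?m (in_charts \<alpha> c0 c) a (snd c0 (id p))"
    using atl \<alpha>(2) by (intro analytic_between_has_jacobian) auto
  note comp = compatible_charts_jacobian[OF manifold_compatible[OF M atl(1,2)] atl(3,4)]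
  have "curry (tangent_map M M \<alpha> p v) c =
      differential ?m ?m (in_charts \<alpha> c0 c) (snd c0 (id p)) (curry v c0)"
    using c \<alpha>(2) by (simp add: tangent_map_def Let_def fun_eq_iff flip: c0_def)
  also have "curry v c0 = differential ?m ?m (in_charts id c c0) (snd c p) (curry v c)"
    using v c c0 unfolding tangent_space_def by blast
  also have "differential ?m ?m (in_charts \<alpha> c0 c) (snd c0 (id p)) \<dots> =
      differential ?m ?m (in_charts \<alpha> c c) (snd c p) (curry v c)"
    by (rule in_charts_compose(2)[OF comp(1) jac is_chart_inj[OF ch(1)] is_chart_inj[OF ch(2)]
          comp(2), symmetric])
      (use atl is_chart_coord_space[OF ch(2)] in auto)
  finally show ?thesis .
qed

end

section \<open>Dynamics near the fixed point\<close>

lemma curry_simps: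
  "curry (u + v) c = curry u c + curry v c" "curry (fscale a u) c = fscale a (curry u c)"
  "curry 0 c = 0"
  by (auto simp: fun_eq_iff plus_fun_apply fscale_def zero_fun_apply)

lemma differential_linear:
  "differential m n F x (u + v) = differential m n F x u + differential m n F x v"
  "differential m n F x (fscale a u) = fscale a (differential m n F x u)"
  by (auto simp: fun_eq_iff plus_fun_apply fscale_def differential_def sum.distrib
      distrib_left sum_distrib_left mult.left_commute)

lemma differential_coord_space: "differential m n F x h \<in> coord_space n"
  by (auto simp: differential_def coord_space_def)

lemma coord_space_closed:
  "0 \<in> coord_space n" "u \<in> coord_space n \<Longrightarrow> v \<in> coord_space n \<Longrightarrow> u + v \<in> coord_space n"
  "u \<in> coord_space n \<Longrightarrow> fscale a u \<in> coord_space n"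
  by (auto simp: coord_space_def plus_fun_apply zero_fun_apply fscale_def)

lemma subspace_tangent_space:
  fixes M :: "('g, 'k::td_local_field) analytic_structure"
  shows "fun_space.subspace (tangent_space M p)"
proof -
  let ?D = "\<lambda>c c'. differential (mdim M) (mdim M) (in_charts id c c') (snd c p)"
  have T: "v \<in> tangent_space M p \<longleftrightarrow> (\<forall>c\<in>charts_at M p. curry v c \<in> coord_space (mdim M)) \<and>
      (\<forall>c. c \<notin> charts_at M p \<longrightarrow> curry v c = 0) \<and>
      (\<forall>c\<in>charts_at M p. \<forall>c'\<in>charts_at M p. curry v c' = ?D c c' (curry v c))" for v
    by (simp only: tangent_space_def mem_Collect_eq zero_fun_def)
  show ?thesis
  proof (rule fun_space.subspaceI)
    have "?D c c' 0 = 0" for c c' :: "('g, 'k) chart"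
      by (auto simp: fun_eq_iff differential_def zero_fun_apply)
    then show "0 \<in> tangent_space M p"
      unfolding T curry_simps by (simp add: coord_space_closed)
  next
    fix u v assume "u \<in> tangent_space M p" "v \<in> tangent_space M p"
    note uv = this[unfolded T]
    show "u + v \<in> tangent_space M p"
      unfolding T curry_simps differential_linear
    proof (intro conjI ballI allI impI)
      fix c c' assume "c \<in> charts_at M p" "c' \<in> charts_at M p"
      then have "curry u c' = ?D c c' (curry u c)" "curry v c' = ?D c c' (curry v c)"
        using uv by blast+
      then show "curry u c' + curry v c' = ?D c c' (curry u c) + ?D c c' (curry v c)"
        by (rule arg_cong2)
    qed (use uv[THEN conjunct1] uv[THEN conjunct2, THEN conjunct1] in
        \<open>simp_all add: coord_space_closed del: split_paired_All\<close>)
  next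
    fix a v assume "v \<in> tangent_space M p"
    note v = this[unfolded T]
    show "fscale a v \<in> tangent_space M p"
      unfolding T curry_simps differential_linear
    proof (intro conjI ballI allI impI)
      fix c c' assume "c \<in> charts_at M p" "c' \<in> charts_at M p"
      then have "curry v c' = ?D c c' (curry v c)" using v by blast
      then show "fscale a (curry v c') = fscale a (?D c c' (curry v c))" by (rule arg_cong)
    qed (use v[THEN conjunct1] v[THEN conjunct2, THEN conjunct1] in
        \<open>simp_all add: coord_space_closed fscale_simps del: split_paired_All\<close>)
  qed
qed

lemma fun_endo_tangent_map:
  fixes f :: "'g \<Rightarrow> 'g"
  shows "fun_endo (tangent_map M N f p)"
proof
  fix u v
  show "tangent_map M N f p (u + v) = tangent_map M N f p u + tangent_map M N f p v"
    by (rule ext) (auto simp: tangent_map_def Let_def curry_simps differential_linear plus_fun_apply)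
next
  fix a v
  show "tangent_map M N f p (fscale a v) = fscale a (tangent_map M N f p v)"
    by (rule ext) (auto simp: tangent_map_def Let_def curry_simps differential_linear fscale_apply)
qed

text \<open>A tangent map reads its argument through one chart and applies a matrix of partial
  derivatives, so the same formula with entries moved by \<open>to_ac\<close> is defined for all
  functions with values in the algebraic closure.\<close>

lemma tangent_map_extend_scalars:
  fixes f :: "'g \<Rightarrow> 'g"
  shows "\<exists>B. fun_endo B \<and> (\<forall>v. B (to_ac \<circ> v) = to_ac \<circ> tangent_map M N f p v)"
proof -
  define c where "c = (SOME c. c \<in> charts_at M p)"
  define D where "D = (\<lambda>c' i j. to_ac (partial_deriv (in_charts f c c') i j (snd c p)))"
  define B where "B = (\<lambda>w (c', i). if c' \<in> charts_at N (f p) \<and> i < mdim N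
    then \<Sum>j<mdim M. D c' i j * w (c, j) else 0)"
  have "fun_endo B"
    by unfold_locales
      (auto simp: B_def fun_eq_iff plus_fun_apply fscale_def sum.distrib distrib_left
        sum_distrib_left mult.left_commute)
  moreover have "B (to_ac \<circ> v) = to_ac \<circ> tangent_map M N f p v" for v
    by (auto simp: B_def D_def fun_eq_iff tangent_map_def Let_def differential_def to_ac_sum
        simp flip: c_def)
  ultimately show ?thesis by blast
qed

lemma sum_of_subspaces_subset:
  assumes "characteristic_subspaces avc E \<beta> Es" "fun_space.subspace E"
  shows "sum_of_subspaces I Es \<subseteq> E"
  unfolding sum_of_subspaces_def
proof (rule fun_space.span_minimal[OF _ assms(2)], rule UN_least)
  fix \<rho>
  note Es = assms(1)[unfolded characteristic_subspaces_def Let_def]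
  show "Es \<rho> \<subseteq> E"
  proof (cases "\<rho> \<in> characteristic_values avc E \<beta>")
    case True
    then show ?thesis using Es[THEN conjunct1, THEN bspec, OF True] by (elim conjE)
  next
    case False
    then have "Es \<rho> = {0}" using Es[THEN conjunct2, THEN conjunct1] by blast
    then show ?thesis using fun_space.subspace_0[OF assms(2)] by simp
  qed
qed

locale adapted_endo = local_value av for av :: "'a::td_local_field \<Rightarrow> real" +
  fixes M :: "('g, 'a) analytic_structure" and d :: nat and N :: "'g set"
    and \<alpha> :: "'g \<Rightarrow> 'g" and p :: 'g and c :: "('g, 'a) chart"
  assumes M: "analytic_manifold M" and N: "submanifold M d N"
    and c: "c \<in> adapted_charts M d N" and p: "p \<in> fst c" "p \<in> N"
    and \<alpha>: "analytic_map M M \<alpha>" "\<alpha> p = p"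
begin

abbreviation "m \<equiv> mdim M"

text \<open>The derivative in the ambient coordinates. Its values on \<open>coord_space d\<close>
  are measured by \<open>vnorm m\<close>, as they are not assumed to lie in
  \<open>coord_space d\<close> again.\<close>

definition L :: "(nat \<Rightarrow> 'a) \<Rightarrow> nat \<Rightarrow> 'a" where
  "L = differential m m (in_charts \<alpha> c c) (snd c p)"

definition rel :: "'g \<Rightarrow> nat \<Rightarrow> 'a" where
  "rel x = snd c x - snd c p"

lemma c_atlas: "c \<in> atlas M"
  using c by (simp add: adapted_charts_def)

lemma chart: "is_chart (mtop M) m c"
  by (rule manifold_chart[OF M c_atlas])

lemma rel_eq_0D:
  assumes "x \<in> fst c" "vnorm m (rel x) = 0"
  shows "x = p"
proof -
  have "rel x \<in> coord_space m"
    using is_chart_coord_space[OF chart] assms(1) p(1)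
    by (auto simp: rel_def coord_space_def minus_apply image_subset_iff)
  from vnorm_eq_0D[OF assms(2) this] have "snd c x = snd c p" by (simp add: rel_def)
  then show ?thesis using is_chart_inj[OF chart] assms(1) p(1) by (auto dest: inj_onD)
qed

lemma rel_coord_space: "x \<in> fst c \<Longrightarrow> x \<in> N \<Longrightarrow> rel x \<in> coord_space d"
  using adapted_chart_mem[OF M c, of x] adapted_chart_mem[OF M c, of p] p
  by (auto simp: rel_def coord_space_def minus_apply)

sublocale L: fun_endo L
  by unfold_locales (auto simp: L_def differential_linear)

lemma L_bounded: "\<exists>K\<ge>1. \<forall>j h. vnorm m ((L ^^ j) h) \<le> K ^ j * vnorm m h"
proof -
  let ?a = "\<lambda>i j. partial_deriv (in_charts \<alpha> c c) i j (snd c p)"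
  obtain K where K: "K \<ge> 1" "\<And>i j. i < m \<Longrightarrow> j < m \<Longrightarrow> av (?a i j) \<le> K"
    using matrix_bound[of m m ?a] by blast
  have 1: "vnorm m (L h) \<le> K * vnorm m h" for h
    using K(1) by (auto simp: vnorm_le_iff L_def differential_def intro!: av_linear_le K(2))
  have "vnorm m ((L ^^ j) h) \<le> K ^ j * vnorm m h" for j h
  proof (induction j)
    case (Suc j)
    have "vnorm m ((L ^^ Suc j) h) \<le> K * vnorm m ((L ^^ j) h)" using 1 by simp
    also have "\<dots> \<le> K * (K ^ j * vnorm m h)" using K(1) Suc by (intro mult_left_mono) auto
    finally show ?case by (simp add: mult.assoc)
  qed simp
  with K(1) show ?thesis by blast
qed

lemma first_order:
  assumes e: "e > 0"
  shows "\<exists>r>0. \<forall>x\<in>fst c. vnorm m (rel x) < r \<longrightarrow>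
    \<alpha> x \<in> fst c \<and> vnorm m (rel (\<alpha> x) - L (rel x)) \<le> e * vnorm m (rel x)"
proof -
  let ?U = "{x \<in> fst c. \<alpha> x \<in> fst c}" and ?f = "in_charts \<alpha> c c"
  have inj: "inj_on (snd c) (fst c)" by (rule is_chart_inj[OF chart])
  have ana: "analytic_between m m (snd c ` ?U) ?f"
    using \<alpha>(1) c_atlas by (auto simp: analytic_map_def)
  have pU: "snd c p \<in> snd c ` ?U" using p \<alpha>(2) by auto
  obtain a where a: "has_jacobian m m ?f a (snd c p)"
    using analytic_between_has_jacobian[OF ana pU] by blast
  obtain r1 where r1: "r1 > 0" "\<And>h. h \<in> coord_space m \<Longrightarrow> vnorm m h < r1 \<Longrightarrow> snd c p + h \<in> snd c ` ?U"
    using openin_coord_spaceD[of m "snd c ` ?U" "snd c p"] ana pU by (auto simp: analytic_between_def)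
  obtain r2 where r2: "r2 > 0" "\<And>h i. h \<in> coord_space m \<Longrightarrow> vnorm m h < r2 \<Longrightarrow> i < m \<Longrightarrow>
      av (?f (snd c p + h) i - ?f (snd c p) i - (\<Sum>j<m. a i j * h j)) \<le> e * vnorm m h"
    using a[unfolded has_jacobian_def, rule_format, OF e] by auto
  have "\<alpha> x \<in> fst c \<and> vnorm m (rel (\<alpha> x) - L (rel x)) \<le> e * vnorm m (rel x)"
    if x: "x \<in> fst c" "vnorm m (rel x) < min r1 r2" for x
  proof
    have h: "rel x \<in> coord_space m"
      using is_chart_coord_space[OF chart] x(1) p(1)
      by (auto simp: rel_def coord_space_def minus_apply image_subset_iff)
    have eq: "snd c p + rel x = snd c x" by (simp add: rel_def)
    have "snd c x \<in> snd c ` ?U" using r1(2)[OF h] x(2) eq by simp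
    then show *: "\<alpha> x \<in> fst c" using inj x(1) by (auto dest: inj_onD)
    have "av ((rel (\<alpha> x) - L (rel x)) i) \<le> e * vnorm m (rel x)" if i: "i < m" for i
    proof -
      have "?f (snd c x) = snd c (\<alpha> x)" "?f (snd c p) = snd c p"
        using in_charts_apply[OF inj x(1), of \<alpha> c] in_charts_apply[OF inj p(1), of \<alpha> c] \<alpha>(2) by auto
      moreover have "L (rel x) i = (\<Sum>j<m. a i j * rel x j)"
        using i by (simp add: L_def has_jacobian_differential[OF a])
      ultimately show ?thesis
        using r2(2)[OF h _ i] x(2) by (simp add: eq) (simp add: rel_def minus_apply)
    qed
    then show "vnorm m (rel (\<alpha> x) - L (rel x)) \<le> e * vnorm m (rel x)"
      using e by (auto simp: vnorm_le_iff)
  qed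
  moreover have "min r1 r2 > 0" using r1 r2 by simp
  ultimately show ?thesis by blast
qed

lemma openin_rel_ball: "openin (subtopology (mtop M) N) {x \<in> fst c \<inter> N. vnorm m (rel x) < r}"
proof -
  have op: "openin (mtop M) (fst c)"
    and hom: "homeomorphic_map (subtopology (mtop M) (fst c)) (top_of_set (snd c ` fst c)) (snd c)"
    using chart by (auto simp: is_chart_def)
  let ?B = "{y \<in> coord_space m. vnorm m (y - snd c p) < r}"
  have sub: "fst c \<subseteq> topspace (mtop M)" using op openin_subset by blast
  have "snd c ` fst c \<subseteq> coord_space m" by (rule is_chart_coord_space[OF chart])
  moreover obtain T where "open T" "?B = coord_space m \<inter> T"
    using openin_vnorm_ball[of m "snd c p" r] unfolding openin_open by blast
  ultimately have "?B \<inter> snd c ` fst c = snd c ` fst c \<inter> T" by blast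
  with \<open>open T\<close> have "openin (top_of_set (snd c ` fst c)) (?B \<inter> snd c ` fst c)"
    by (simp only: openin_open_Int)
  from openin_continuous_map_preimage[OF homeomorphic_imp_continuous_map[OF hom] this]
  moreover have "{x \<in> topspace (subtopology (mtop M) (fst c)). snd c x \<in> ?B \<inter> snd c ` fst c} =
      {x \<in> fst c. vnorm m (rel x) < r}"
    using sub is_chart_coord_space[OF chart] by (auto simp: rel_def image_subset_iff)
  ultimately have "openin (subtopology (mtop M) (fst c)) {x \<in> fst c. vnorm m (rel x) < r}"
    by (simp only:)
  then have "openin (mtop M) {x \<in> fst c. vnorm m (rel x) < r}"
    using op by (rule openin_trans_full)
  from openin_subtopology_Int[OF this, of N]
  have "openin (subtopology (mtop M) N) ({x \<in> fst c. vnorm m (rel x) < r} \<inter> N)" .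
  moreover have "{x \<in> fst c. vnorm m (rel x) < r} \<inter> N = {x \<in> fst c \<inter> N. vnorm m (rel x) < r}"
    by blast
  ultimately show ?thesis by (simp only:)
qed

lemma fibre_isolated:
  assumes C: "0 \<le> C" "\<And>h. h \<in> coord_space d \<Longrightarrow> vnorm m h \<le> C * vnorm m (L h)"
  shows "\<exists>r>0. \<forall>x\<in>fst c \<inter> N. vnorm m (rel x) < r \<longrightarrow> \<alpha> x = p \<longrightarrow> x = p"
proof -
  \<comment> \<open>Chosen so that \<open>C * e\<close> is at most 1/2, with the added 1 covering
    \<open>C = 0\<close>. At a point mapped to \<open>p\<close> the first-order estimate gives
    \<open>|L h| \<le> e |h|\<close>, hence \<open>|h| \<le> |h| / 2\<close>.\<close>
  define e where "e = 1 / (2 * (C + 1))"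
  have e: "e > 0" "C * e \<le> 1 / 2" using C(1) by (auto simp: e_def field_simps)
  obtain r where r: "r > 0" "\<And>x. x \<in> fst c \<Longrightarrow> vnorm m (rel x) < r \<Longrightarrow>
      vnorm m (rel (\<alpha> x) - L (rel x)) \<le> e * vnorm m (rel x)"
    using first_order[OF e(1)] by blast
  have "x = p" if x: "x \<in> fst c" "x \<in> N" "vnorm m (rel x) < r" "\<alpha> x = p" for x
  proof -
    have "rel (\<alpha> x) - L (rel x) = - L (rel x)" using x(4) by (simp add: rel_def)
    then have "vnorm m (L (rel x)) \<le> e * vnorm m (rel x)"
      using r(2)[OF x(1,3)] by simp
    then have "C * vnorm m (L (rel x)) \<le> C * (e * vnorm m (rel x))"
      using C(1) by (intro mult_left_mono)
    also have "\<dots> \<le> 1 / 2 * vnorm m (rel x)"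
      unfolding mult.assoc[symmetric] using e(2) by (intro mult_right_mono) auto
    finally have "vnorm m (rel x) \<le> 1 / 2 * vnorm m (rel x)"
      using C(2)[OF rel_coord_space[OF x(1,2)]] by linarith
    then have "vnorm m (rel x) = 0" using vnorm_nonneg[of m "rel x"] by linarith
    then show ?thesis using rel_eq_0D x(1) by blast
  qed
  with r(1) show ?thesis by auto
qed

text \<open>\<open>vnorm m\<close> itself need not be preserved: a unipotent matrix with large
  off-diagonal entries has only the eigenvalue 1 and still stretches vectors. Including the iterates
  up to the degree of an annihilating polynomial repairs this.\<close>

definition anorm :: "nat \<Rightarrow> (nat \<Rightarrow> 'a) \<Rightarrow> real" where
  "anorm D h = Max ((\<lambda>j. vnorm m ((L ^^ j) h)) ` {..D})"

lemma anorm_le_iff: "anorm D h \<le> B \<longleftrightarrow> (\<forall>j\<le>D. vnorm m ((L ^^ j) h) \<le> B)"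
  unfolding anorm_def by (subst Max_le_iff) auto

lemma le_anorm: "j \<le> D \<Longrightarrow> vnorm m ((L ^^ j) h) \<le> anorm D h"
  using anorm_le_iff[of D h "anorm D h"] by simp

lemma vnorm_le_anorm: "vnorm m h \<le> anorm D h"
  using le_anorm[of 0 D h] by simp

lemma anorm_nonneg: "0 \<le> anorm D h"
  using vnorm_le_anorm[of h D] vnorm_nonneg[of m h] by linarith

lemma L_pow_add: "(L ^^ j) (u + v) = (L ^^ j) u + (L ^^ j) v"
  by (induction j) (simp_all add: L.add)

lemma L_pow_minus: "(L ^^ j) (- u) = - (L ^^ j) u"
proof -
  have "(L ^^ j) 0 = 0" by (induction j) simp_all
  then show ?thesis using L_pow_add[of j u "- u"] by (simp add: eq_neg_iff_add_eq_0 add.commute)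
qed

lemma anorm_add: "anorm D (u + v) \<le> max (anorm D u) (anorm D v)"
proof -
  have "vnorm m ((L ^^ j) (u + v)) \<le> max (anorm D u) (anorm D v)" if "j \<le> D" for j
    using vnorm_add[of m "(L ^^ j) u" "(L ^^ j) v"] le_anorm[OF that, of u] le_anorm[OF that, of v]
    unfolding L_pow_add by linarith
  then show ?thesis by (auto simp only: anorm_le_iff)
qed

lemma anorm_minus: "anorm D (- u) = anorm D u"
  by (simp add: anorm_def L_pow_minus)

lemma anorm_bounded: "\<exists>K\<ge>1. \<forall>h. anorm D h \<le> K * vnorm m h"
proof -
  obtain K where K: "K \<ge> 1" "\<And>j h. vnorm m ((L ^^ j) h) \<le> K ^ j * vnorm m h"
    using L_bounded by blast
  have "vnorm m ((L ^^ j) h) \<le> K ^ D * vnorm m h" if "j \<le> D" for j h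
    using K(2)[of j h] mult_right_mono[OF power_increasing[OF that K(1)], of "vnorm m h"] by simp
  then have "anorm D h \<le> K ^ D * vnorm m h" for h by (auto simp only: anorm_le_iff)
  moreover have "K ^ D \<ge> 1" using K(1) by simp
  ultimately show ?thesis by blast
qed

lemma isometric_iterated_fibre_isolated:
  assumes iso: "\<And>h. h \<in> coord_space d \<Longrightarrow> anorm D (L h) = anorm D h"
    and N\<alpha>: "\<alpha> ` N \<subseteq> N"
  shows "\<exists>r>0. \<forall>x\<in>fst c \<inter> N. vnorm m (rel x) < r \<longrightarrow> (\<forall>n. (\<alpha> ^^ n) x = p \<longrightarrow> x = p)"
proof -
  obtain K where K: "K \<ge> 1" "\<And>h. anorm D h \<le> K * vnorm m h"
    using anorm_bounded by blast
  \<comment> \<open>The factor \<open>K\<close> turns the error estimate for \<open>vnorm\<close>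
    into one for \<open>anorm\<close> with factor 1/2.\<close>
  define e where "e = 1 / (2 * K)"
  have e: "e > 0" "K * e = 1 / 2" using K(1) by (auto simp: e_def field_simps)
  obtain r where r: "r > 0" "\<And>x. x \<in> fst c \<Longrightarrow> vnorm m (rel x) < r \<Longrightarrow>
      \<alpha> x \<in> fst c \<and> vnorm m (rel (\<alpha> x) - L (rel x)) \<le> e * vnorm m (rel x)"
    using first_order[OF e(1)] by blast
  have step: "\<alpha> x \<in> fst c \<and> \<alpha> x \<in> N \<and> anorm D (rel (\<alpha> x)) = anorm D (rel x)"
    if x: "x \<in> fst c" "x \<in> N" "anorm D (rel x) < r" for x
  proof -
    let ?h = "rel x" and ?q = "rel (\<alpha> x) - L (rel x)"
    have "vnorm m ?h < r" using vnorm_le_anorm[of ?h D] x(3) by linarith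
    note rx = r(2)[OF x(1) this]
    have "anorm D ?q \<le> K * vnorm m ?q" by (rule K)
    also have "\<dots> \<le> K * (e * vnorm m ?h)" using rx K(1) by (intro mult_left_mono) auto
    also have "\<dots> = 1 / 2 * vnorm m ?h" using e(2) by (simp add: mult.assoc[symmetric])
    also have "\<dots> \<le> 1 / 2 * anorm D ?h" using vnorm_le_anorm[of ?h D] by simp
    finally have q: "anorm D ?q \<le> 1 / 2 * anorm D ?h" .
    have iso_h: "anorm D (L ?h) = anorm D ?h" using iso rel_coord_space x by blast
    have "rel (\<alpha> x) = L ?h + ?q" by simp
    then have 1: "anorm D (rel (\<alpha> x)) \<le> max (anorm D ?h) (anorm D ?q)"
      using anorm_add[of D "L ?h" ?q] iso_h by simp
    have "L ?h = rel (\<alpha> x) + - ?q" by simp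
    then have 2: "anorm D ?h \<le> max (anorm D (rel (\<alpha> x))) (anorm D ?q)"
      using anorm_add[of D "rel (\<alpha> x)" "- ?q"] iso_h unfolding anorm_minus by simp
    \<comment> \<open>The error \<open>?q\<close> is at most half of \<open>anorm D ?h\<close>, so
      it cannot decide either maximum unless both norms vanish, and the two ultrametric inequalities
      give equality.\<close>
    have "anorm D (rel (\<alpha> x)) = anorm D ?h"
      using 1 2 q anorm_nonneg[of D ?h] anorm_nonneg[of D "rel (\<alpha> x)"] by linarith
    then show ?thesis using rx N\<alpha> x(2) by blast
  qed
  have iter: "(\<alpha> ^^ n) x \<in> fst c \<and> (\<alpha> ^^ n) x \<in> N \<and> anorm D (rel ((\<alpha> ^^ n) x)) = anorm D (rel x)"
    if x: "x \<in> fst c" "x \<in> N" "anorm D (rel x) < r" for x n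
  proof (induction n)
    case (Suc n)
    then show ?case using step[of "(\<alpha> ^^ n) x"] x(3) by simp
  qed (use x in simp)
  \<comment> \<open>Invariance holds for \<open>anorm\<close> balls; since \<open>anorm D\<close> is
    at most \<open>K * vnorm m\<close>, the radius \<open>r / K\<close> puts a \<open>vnorm\<close>
    ball inside one.\<close>
  have "x = p" if x: "x \<in> fst c" "x \<in> N" "vnorm m (rel x) < r / K" "(\<alpha> ^^ n) x = p" for x n
  proof -
    have "K * vnorm m (rel x) < r" using x(3) K(1) by (simp add: field_simps)
    then have "anorm D (rel x) < r" using K(2)[of "rel x"] by linarith
    then have "anorm D (rel x) = anorm D (rel p)" using iter[OF x(1,2), of n] x(4) by simp
    also have "\<dots> \<le> 0" using K(2)[of "rel p"] by (simp add: rel_def)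
    finally have "vnorm m (rel x) = 0"
      using vnorm_le_anorm[of "rel x" D] vnorm_nonneg[of m "rel x"] by linarith
    then show ?thesis using rel_eq_0D x(1) by blast
  qed
  moreover have "r / K > 0" using r(1) K(1) by simp
  ultimately show ?thesis by blast
qed

text \<open>The polynomial is a product of annihilators of finitely many tangent vectors whose
  coordinates are the unit vectors, hence independent of \<open>h\<close>. Applying powers of
  \<open>B\<close> to the relation gives the shifts by \<open>k\<close>, which will control an
  iterate beyond the degree.\<close>

lemma annihilating_polynomial:
  assumes Es: "characteristic_subspaces avc (tangent_space M p) (tangent_map M M \<alpha> p) Es"
    and S: "sub_tangent_space M d N p \<subseteq> sum_of_subspaces I Es"
    and Q: "Q 1" "\<And>P P'. Q P \<Longrightarrow> Q P' \<Longrightarrow> Q (P * P')" "\<And>\<mu>. avc \<mu> \<in> I \<Longrightarrow> Q [:- \<mu>, 1:]"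
  shows "\<exists>P. Q P \<and> (\<forall>h\<in>coord_space d. \<forall>k i.
           (\<Sum>j\<le>Polynomial.degree P. poly.coeff P j * to_ac ((L ^^ (j + k)) h i)) = 0)"
proof -
  let ?E = "tangent_space M p" and ?b = "tangent_map M M \<alpha> p"
  obtain B where B: "fun_endo B" "\<And>v. B (to_ac \<circ> v) = to_ac \<circ> ?b v"
    using tangent_map_extend_scalars[of M M \<alpha> p] by blast
  have inv: "?b v \<in> ?E" if "v \<in> ?E" for v
    by (rule characteristic_subspaces_invariant[OF Es fun_endo_tangent_map subspace_tangent_space that])
  have ext: "extended_endo B ?E ?b"
    using B inv by (simp add: extended_endo_def extended_endo_axioms_def)
  interpret B: extended_endo B ?E ?b by (rule ext)
  have S_E: "sub_tangent_space M d N p \<subseteq> ?E"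
    using S sum_of_subspaces_subset[OF Es subspace_tangent_space] by blast
  define u where "u k = (\<lambda>i. if i = k then 1 else 0 :: 'a)" for k :: nat
  have "\<forall>k. \<exists>v. k < d \<longrightarrow> v \<in> sub_tangent_space M d N p \<and> curry v c = u k"
  proof
    fix k
    have "u k \<in> coord_space d" if "k < d" using that by (auto simp: u_def coord_space_def)
    then show "\<exists>v. k < d \<longrightarrow> v \<in> sub_tangent_space M d N p \<and> curry v c = u k"
      using sub_tangent_space_coordinates[OF M N c p] by blast
  qed
  then obtain v where v: "\<And>k. k < d \<Longrightarrow> v k \<in> sub_tangent_space M d N p"
    "\<And>k. k < d \<Longrightarrow> curry (v k) c = u k"
    by metis
  have "\<exists>P. Q P \<and> (\<forall>w\<in>v ` {..<d}. B.poly_op P (to_ac \<circ> w) = 0)"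
  proof (rule B.finite_annihilated[where U = "{\<mu>. avc \<mu> \<in> I}"])
    fix w assume "w \<in> v ` {..<d}"
    then have "w \<in> sum_of_subspaces I Es" using v(1) S by blast
    from sum_of_subspaces_annihilated[OF Es ext Q this]
    show "\<exists>P. Q P \<and> B.poly_op P (to_ac \<circ> w) = 0" by blast
  qed (use Q in auto)
  then obtain P where P: "Q P" "\<And>k. k < d \<Longrightarrow> B.poly_op P (to_ac \<circ> v k) = 0" by auto
  have "(\<Sum>j\<le>Polynomial.degree P. poly.coeff P j * to_ac ((L ^^ (j + k)) h i)) = 0"
    if h: "h \<in> coord_space d" for h k i
  proof -
    \<comment> \<open>The tangent vector whose coordinates in \<open>c\<close> are \<open>h\<close>.
      Its iterates under the tangent map have coordinates \<open>(L ^^ j) h\<close>, so the abstract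
      relation can be read off in this chart.\<close>
    define w where "w = (\<Sum>l<d. fscale (h l) (v l))"
    have w: "w \<in> ?E"
      unfolding w_def using v(1) S_E subspace_tangent_space[of M p]
      by (intro fun_space.subspace_sum fun_space.subspace_scale) auto
    have "curry w c i = h i" for i
    proof -
      have "curry w c i = (\<Sum>l<d. h l * curry (v l) c i)"
        by (simp add: w_def sum_fun_apply fscale_apply)
      also have "\<dots> = (\<Sum>l<d. if l = i then h l else 0)"
        using v(2) by (intro sum.cong) (auto simp: u_def)
      also have "\<dots> = h i" using h by (auto simp: coord_space_def)
      finally show ?thesis .
    qed
    then have cw: "curry w c = h" by blast
    have cM: "c \<in> charts_at M p" using c_atlas p by (simp add: charts_at_def)
    have pow: "(?b ^^ j) w \<in> ?E \<and> curry ((?b ^^ j) w) c = (L ^^ j) h" for j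
    proof (induction j)
      case (Suc j)
      have "curry (?b ((?b ^^ j) w)) c = L (curry ((?b ^^ j) w) c)"
        unfolding L_def using Suc by (intro tangent_map_in_chart[OF M \<alpha> cM]) simp
      then show ?case
        using inv[of "(?b ^^ j) w"] Suc by (simp only: funpow.simps comp_apply simp_thms)
    qed (use w cw in simp)
    have "to_ac \<circ> w = (\<Sum>l<d. fscale (to_ac (h l)) (to_ac \<circ> v l))"
      by (auto simp: fun_eq_iff w_def sum_fun_apply fscale_apply to_ac_sum)
    then have "B.poly_op P (to_ac \<circ> w) = (\<Sum>l<d. fscale (to_ac (h l)) (B.poly_op P (to_ac \<circ> v l)))"
      by (simp only: B.poly_op_sum B.poly_op_scale)
    also have "\<dots> = 0" using P(2) by (intro sum.neutral) (auto simp: fscale_simps)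
    finally have 0: "B.poly_op P (to_ac \<circ> w) = 0" .
    have "B.poly_op P ((B ^^ k) (to_ac \<circ> w)) = 0"
      by (induction k) (simp_all add: 0 B.poly_op_commute del: comp_apply, simp add: B.poly_op_commute)
    then have "(\<Sum>j\<le>Polynomial.degree P. fscale (poly.coeff P j) ((B ^^ (j + k)) (to_ac \<circ> w))) (c, i) = 0"
      by (simp only: B.poly_op_def funpow_add comp_apply zero_fun_apply)
    moreover have "(B ^^ (j + k)) (to_ac \<circ> w) (c, i) = to_ac ((L ^^ (j + k)) h i)" for j
      using pow[of "j + k"] unfolding B.B_pow_to_ac by (auto simp: fun_eq_iff)
    ultimately show ?thesis
      by (simp only: sum_fun_apply fscale_apply)
  qed
  with P(1) show ?thesis by blast
qed

section \<open>Estimates drawn from the annihilating polynomial\<close>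

context
  fixes avc :: "'a alg_closure \<Rightarrow> real" and P :: "'a alg_closure poly"
  assumes avc: "ultrametric_value avc" "\<And>x. avc (to_ac x) = av x"
    and P: "\<And>h k i. h \<in> coord_space d \<Longrightarrow>
      (\<Sum>j\<le>Polynomial.degree P. poly.coeff P j * to_ac ((L ^^ (j + k)) h i)) = 0"
begin

lemma vnorm_le_vnorm_L:
  assumes P0: "poly.coeff P 0 \<noteq> 0"
  shows "\<exists>C\<ge>0. \<forall>h\<in>coord_space d. vnorm m h \<le> C * vnorm m (L h)"
proof -
  interpret avc: ultrametric_value avc by (rule avc(1))
  let ?D = "Polynomial.degree P"
  obtain K where K: "K \<ge> 1" "\<And>j h. vnorm m ((L ^^ j) h) \<le> K ^ j * vnorm m h"
    using L_bounded by blast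
  define A where "A = Max ((\<lambda>j. avc (poly.coeff P j)) ` {..?D})"
  have A: "avc (poly.coeff P j) \<le> A" if "j \<le> ?D" for j
    unfolding A_def using that by (intro Max_ge) auto
  have A0: "0 \<le> A" by (rule order_trans[OF avc.nonneg A[of 0]]) simp
  define a where "a = avc (poly.coeff P 0)"
  have a: "a > 0" using P0 by (simp add: a_def)
  \<comment> \<open>\<open>A\<close> bounds the coefficients, \<open>K ^ ?D\<close> the iterates
    applied to \<open>L h\<close>, and \<open>a\<close> is the absolute value of the constant
    coefficient, whose term the relation is solved for.\<close>
  have "vnorm m h \<le> A * K ^ ?D / a * vnorm m (L h)" if h: "h \<in> coord_space d" for h
  proof -
    let ?B = "A * (K ^ ?D * vnorm m (L h))"
    have B0: "0 \<le> ?B" using A0 K(1) by simp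
    have "a * av (h i) \<le> ?B" if i: "i < m" for i
    proof -
      have "avc (poly.coeff P 0 * to_ac ((L ^^ (0 + 0)) h i)) \<le> ?B"
      proof (rule avc.sum_isolate[OF _ _ P[OF h] B0])
        fix j assume j: "j \<in> {..?D}" "j \<noteq> 0"
        then obtain l where l: "j = Suc l" by (cases j) auto
        have "av ((L ^^ j) h i) \<le> vnorm m ((L ^^ l) (L h))"
          using le_vnorm[OF i] by (simp add: l funpow_swap1)
        also have "\<dots> \<le> K ^ l * vnorm m (L h)" by (rule K(2))
        also have "\<dots> \<le> K ^ ?D * vnorm m (L h)"
          using K(1) j l by (intro mult_right_mono power_increasing) auto
        finally have "avc (poly.coeff P j) * av ((L ^^ j) h i) \<le> ?B"
          using A j A0 by (intro mult_mono) auto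
        then show "avc (poly.coeff P j * to_ac ((L ^^ (j + 0)) h i)) \<le> ?B"
          by (simp add: avc.mult avc(2))
      qed auto
      then show ?thesis by (simp add: avc.mult avc(2) a_def)
    qed
    then have "av (h i) \<le> ?B / a" if "i < m" for i
      using that a by (simp add: field_simps)
    then have "vnorm m h \<le> ?B / a" using B0 a by (auto simp only: vnorm_le_iff intro!: divide_nonneg_pos)
    then show ?thesis by (simp add: mult.assoc)
  qed
  moreover have "0 \<le> A * K ^ ?D / a" using A0 K(1) a by simp
  ultimately show ?thesis by blast
qed

text \<open>Both the top and the bottom coefficient of \<open>P\<close> are units, so each of \<open>h\<close> and \<open>L\<^sup>D\<^sup>+\<^sup>1 h\<close> is
  bounded by the vectors in between.\<close>

lemma anorm_L:
  assumes coeffs: "\<And>j. avc (poly.coeff P j) \<le> 1" "avc (poly.coeff P 0) = 1"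
      "avc (poly.coeff P (Polynomial.degree P)) = 1"
    and h: "h \<in> coord_space d"
  shows "anorm (Polynomial.degree P) (L h) = anorm (Polynomial.degree P) h"
proof -
  interpret avc: ultrametric_value avc by (rule avc(1))
  let ?D = "Polynomial.degree P"
  have Suc: "(L ^^ j) (L h) = (L ^^ Suc j) h" for j by (simp add: funpow_swap1)
  have bound: "vnorm m ((L ^^ (l + k)) h) \<le> B"
    if l: "l \<le> ?D" "avc (poly.coeff P l) = 1" and B: "0 \<le> B"
      and le: "\<And>j. j \<le> ?D \<Longrightarrow> j \<noteq> l \<Longrightarrow> vnorm m ((L ^^ (j + k)) h) \<le> B" for l k B
  proof -
    have "av ((L ^^ (l + k)) h i) \<le> B" if i: "i < m" for i
    proof -
      have "avc (poly.coeff P l * to_ac ((L ^^ (l + k)) h i)) \<le> B"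
      proof (rule avc.sum_isolate[OF _ _ P[OF h] B])
        fix j assume j: "j \<in> {..?D}" "j \<noteq> l"
        have "av ((L ^^ (j + k)) h i) \<le> B"
          using le[of j] le_vnorm[OF i, of "(L ^^ (j + k)) h"] j by simp
        then have "avc (poly.coeff P j) * av ((L ^^ (j + k)) h i) \<le> 1 * B"
          using coeffs(1) by (intro mult_mono) auto
        then show "avc (poly.coeff P j * to_ac ((L ^^ (j + k)) h i)) \<le> B"
          by (simp add: avc.mult avc(2))
      qed (use l in auto)
      then show ?thesis by (simp add: avc.mult avc(2) l)
    qed
    then show ?thesis using B by (simp add: vnorm_le_iff)
  qed
  show ?thesis
  proof (rule antisym)
    \<comment> \<open>The relation shifted by 1, solved for its top term, bounds the one iterate in
      \<open>anorm ?D (L h)\<close> that does not occur in \<open>anorm ?D h\<close>.\<close>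
    have "vnorm m ((L ^^ (?D + 1)) h) \<le> anorm ?D h"
    proof (rule bound)
      fix j assume "j \<le> ?D" "j \<noteq> ?D"
      then show "vnorm m ((L ^^ (j + 1)) h) \<le> anorm ?D h" by (intro le_anorm) simp
    qed (use coeffs(3) anorm_nonneg in auto)
    then have "vnorm m ((L ^^ j) (L h)) \<le> anorm ?D h" if "j \<le> ?D" for j
      unfolding Suc using that le_anorm[of "Suc j" ?D h] by (cases "j = ?D") auto
    then show "anorm ?D (L h) \<le> anorm ?D h" by (auto simp only: anorm_le_iff)
    have le: "vnorm m ((L ^^ Suc j) h) \<le> anorm ?D (L h)" if "j \<le> ?D" for j
      using le_anorm[OF that, of "L h"] unfolding Suc .
    \<comment> \<open>Conversely, the unshifted relation solved for its bottom term bounds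
      \<open>h\<close>, the one entry of \<open>anorm ?D h\<close> missing from
      \<open>anorm ?D (L h)\<close>.\<close>
    have "vnorm m ((L ^^ (0 + 0)) h) \<le> anorm ?D (L h)"
    proof (rule bound)
      fix j assume "j \<le> ?D" "j \<noteq> 0"
      then show "vnorm m ((L ^^ (j + 0)) h) \<le> anorm ?D (L h)"
        using le[of "j - 1"] by simp
    qed (use coeffs(2) anorm_nonneg in auto)
    moreover have "vnorm m ((L ^^ j) h) \<le> anorm ?D (L h)" if "j \<le> ?D" "j \<noteq> 0" for j
      using le[of "j - 1"] that by simp
    ultimately have "vnorm m ((L ^^ j) h) \<le> anorm ?D (L h)" if "j \<le> ?D" for j
      using that by (cases "j = 0") auto
    then show "anorm ?D h \<le> anorm ?D (L h)" by (auto simp only: anorm_le_iff)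
  qed
qed

end

section \<open>Isolation of the fixed point in its fibres on \<open>N\<close>\<close>

context
  fixes avc :: "'a alg_closure \<Rightarrow> real" and Es I
  assumes avc: "ultrametric_value avc" "\<And>x. avc (to_ac x) = av x"
    and Es: "characteristic_subspaces avc (tangent_space M p) (tangent_map M M \<alpha> p) Es"
    and S: "sub_tangent_space M d N p \<subseteq> sum_of_subspaces I Es"
begin

text \<open>Having a nonzero constant coefficient passes to products, and the linear factor of
  \<open>\<mu>\<close> has it because the values in \<open>I\<close> are positive.\<close>

lemma kernel_isolated:
  assumes I: "I \<subseteq> {0<..}"
  shows "\<exists>W. openin (subtopology (mtop M) N) W \<and> p \<in> W \<and> (\<forall>x\<in>W. \<alpha> x = p \<longrightarrow> x = p)"
proof -
  interpret avc: ultrametric_value avc by (rule avc(1))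
  have "avc \<mu> \<in> I \<Longrightarrow> \<mu> \<noteq> 0" for \<mu> using I by auto
  then have "\<exists>P. poly.coeff P 0 \<noteq> 0 \<and> (\<forall>h\<in>coord_space d. \<forall>k i.
      (\<Sum>j\<le>Polynomial.degree P. poly.coeff P j * to_ac ((L ^^ (j + k)) h i)) = 0)"
    by (intro annihilating_polynomial[OF Es S, where Q = "\<lambda>P. poly.coeff P 0 \<noteq> 0"])
      (auto simp: coeff_mult_0)
  then obtain P where P: "poly.coeff P 0 \<noteq> 0" "\<And>h k i. h \<in> coord_space d \<Longrightarrow>
      (\<Sum>j\<le>Polynomial.degree P. poly.coeff P j * to_ac ((L ^^ (j + k)) h i)) = 0"
    by blast
  obtain C where "0 \<le> C" "\<And>h. h \<in> coord_space d \<Longrightarrow> vnorm m h \<le> C * vnorm m (L h)"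
    using vnorm_le_vnorm_L[OF avc P(2,1)] by blast
  from fibre_isolated[OF this] obtain r where
    r: "r > 0" "\<And>x. x \<in> fst c \<inter> N \<Longrightarrow> vnorm m (rel x) < r \<Longrightarrow> \<alpha> x = p \<Longrightarrow> x = p"
    by blast
  have "p \<in> {x \<in> fst c \<inter> N. vnorm m (rel x) < r}" using p r(1) by (simp add: rel_def)
  with r(2) openin_rel_ball[of r] show ?thesis by blast
qed

lemma iterated_kernel_isolated:
  assumes I: "I = {1}" and N\<alpha>: "\<alpha> ` N \<subseteq> N"
  shows "\<exists>W. openin (subtopology (mtop M) N) W \<and> p \<in> W \<and>
    (\<forall>x\<in>W. \<forall>n. (\<alpha> ^^ n) x = p \<longrightarrow> x = p)"
proof -
  interpret avc: ultrametric_value avc by (rule avc(1))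
  \<comment> \<open>Integral coefficients with units at both ends. The bottom and top coefficients
    of a product are products of those of the factors, and the ultrametric inequality controls the
    others.\<close>
  define Q where "Q P \<longleftrightarrow> (\<forall>j. avc (poly.coeff P j) \<le> 1) \<and> avc (poly.coeff P 0) = 1 \<and>
    avc (poly.coeff P (Polynomial.degree P)) = 1" for P
  have "Q 1" by (auto simp: Q_def)
  moreover have "Q (P * P')" if "Q P" "Q P'" for P P'
  proof -
    have "avc (poly.coeff (P * P') j) \<le> 1" for j
      unfolding coeff_mult
      by (rule avc.sum_le) (use that in \<open>auto simp: Q_def avc.mult intro!: mult_le_one\<close>)
    then show ?thesis
      using that lead_coeff_mult[of P P'] by (auto simp: Q_def avc.mult coeff_mult_0)
  qed
  moreover have "Q [:- \<mu>, 1:]" if "avc \<mu> \<in> I" for \<mu>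
    using that I by (auto simp: Q_def coeff_pCons split: nat.split)
  ultimately obtain P where P: "Q P" "\<And>h k i. h \<in> coord_space d \<Longrightarrow>
      (\<Sum>j\<le>Polynomial.degree P. poly.coeff P j * to_ac ((L ^^ (j + k)) h i)) = 0"
    using annihilating_polynomial[OF Es S, of Q] by blast
  have "anorm (Polynomial.degree P) (L h) = anorm (Polynomial.degree P) h"
    if "h \<in> coord_space d" for h
    using P(1) that by (intro anorm_L[OF avc P(2)]) (auto simp: Q_def)
  from isometric_iterated_fibre_isolated[OF this N\<alpha>] obtain r where
    r: "r > 0" "\<And>x n. x \<in> fst c \<inter> N \<Longrightarrow> vnorm m (rel x) < r \<Longrightarrow> (\<alpha> ^^ n) x = p \<Longrightarrow> x = p"
    by blast
  have "p \<in> {x \<in> fst c \<inter> N. vnorm m (rel x) < r}" using p r(1) by (simp add: rel_def)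
  with r(2) openin_rel_ball[of r] show ?thesis by blast
qed

end

end

section \<open>Discreteness\<close>

text \<open>Left translation by the inverse of \<open>k\<close> is continuous and takes
  \<open>k\<close> to the neutral element, so the preimage of \<open>W\<close> meets
  \<open>K\<close> in \<open>k\<close> only.\<close>

lemma lie_group_discreteI:
  assumes G: "lie_group G T" and K: "K \<subseteq> carrier G"
    and inv: "\<And>x k. x \<in> K \<Longrightarrow> k \<in> K \<Longrightarrow> inv\<^bsub>G\<^esub> k \<otimes>\<^bsub>G\<^esub> x \<in> K"
    and W: "openin (mtop T) W" "\<one>\<^bsub>G\<^esub> \<in> W" "W \<inter> K \<subseteq> {\<one>\<^bsub>G\<^esub>}"
  shows "subtopology (mtop T) K = discrete_topology K"
proof -
  interpret group G using G by (simp add: lie_group_def)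
  have top: "topspace (mtop T) = carrier G"
    and mult: "continuous_map (prod_topology (mtop T) (mtop T)) (mtop T) (\<lambda>(x, y). x \<otimes>\<^bsub>G\<^esub> y)"
    using G by (auto simp: lie_group_def analytic_map_def product_manifold_def)
  have "openin (subtopology (mtop T) K) {k}" if k: "k \<in> K" for k
  proof -
    have kG: "k \<in> carrier G" using k K by blast
    have "continuous_map (mtop T) (prod_topology (mtop T) (mtop T)) (\<lambda>x. (inv\<^bsub>G\<^esub> k, x))"
      using kG by (intro continuous_map_pairedI) (auto simp: top)
    from continuous_map_compose[OF this mult]
    have "continuous_map (mtop T) (mtop T) (\<lambda>x. inv\<^bsub>G\<^esub> k \<otimes>\<^bsub>G\<^esub> x)" by (simp add: o_def)
    from openin_continuous_map_preimage[OF this W(1)]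
    have "openin (subtopology (mtop T) K)
        ({x \<in> topspace (mtop T). inv\<^bsub>G\<^esub> k \<otimes>\<^bsub>G\<^esub> x \<in> W} \<inter> K)"
      by (rule openin_subtopology_Int)
    moreover have "{x \<in> topspace (mtop T). inv\<^bsub>G\<^esub> k \<otimes>\<^bsub>G\<^esub> x \<in> W} \<inter> K = {k}"
    proof (intro equalityI subsetI)
      fix x assume x: "x \<in> {x \<in> topspace (mtop T). inv\<^bsub>G\<^esub> k \<otimes>\<^bsub>G\<^esub> x \<in> W} \<inter> K"
      then have "inv\<^bsub>G\<^esub> k \<otimes>\<^bsub>G\<^esub> x = \<one>\<^bsub>G\<^esub>" using W(3) inv k by blast
      moreover have "x \<in> carrier G" using x K by blast
      ultimately have "x = k \<otimes>\<^bsub>G\<^esub> \<one>\<^bsub>G\<^esub>" using kG by (metis inv_solve_left inv_closed one_closed inv_inv)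
      then show "x \<in> {k}" using kG by simp
    qed (use k kG W(2) top in auto)
    ultimately show ?thesis by simp
  qed
  moreover have "topspace (subtopology (mtop T) K) = K" using K top by (simp add: inf_absorb2)
  ultimately have "discrete_topology K = subtopology (mtop T) K"
    by (subst discrete_topology_unique) blast
  then show ?thesis by (rule sym)
qed

text \<open>The topology of \<open>T\<close> need not be the subspace topology from
  \<open>M\<close>, so isolation in \<open>N\<close> is transferred through the equality of induced
  structures: a relatively open subset of \<open>N\<close> in \<open>M\<close> is open in
  \<open>T\<close> because \<open>N\<close> is.\<close>

lemma lie_structure_discreteI:
  assumes G: "group G" and H: "H \<subseteq> carrier G" and K: "subgroup K G"
    and T: "lie_structure_with_open_subset G M H Q T"
    and Q: "\<And>d N. submanifold M d N \<Longrightarrow> Q d N \<Longrightarrow>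
      \<exists>W. openin (subtopology (mtop M) N) W \<and> \<one>\<^bsub>G\<^esub> \<in> W \<and> W \<inter> K \<subseteq> {\<one>\<^bsub>G\<^esub>}"
  shows "subtopology (mtop T) (K \<inter> H) = discrete_topology (K \<inter> H)"
proof -
  interpret group G by (rule G)
  let ?H = "G\<lparr>carrier := H\<rparr>"
  have lie: "lie_group ?H T" using T by (simp add: lie_structure_with_open_subset_def)
  obtain d N where N: "openin (mtop T) N" "submanifold M d N" "Q d N"
    and eq: "induced_structure T (mdim T) N = induced_structure M d N"
    using T unfolding lie_structure_with_open_subset_def by blast
  obtain W where W: "openin (subtopology (mtop M) N) W" "\<one>\<^bsub>G\<^esub> \<in> W" "W \<inter> K \<subseteq> {\<one>\<^bsub>G\<^esub>}"
    using Q[OF N(2,3)] by blast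
  have "subtopology (mtop T) N = subtopology (mtop M) N"
    using arg_cong[OF eq, of mtop] by (simp add: induced_structure_simps)
  then have "openin (mtop T) W" using W(1) N(1) openin_trans_full by metis
  moreover interpret H: group ?H using lie by (simp add: lie_group_def)
  have "inv\<^bsub>?H\<^esub> k \<otimes>\<^bsub>?H\<^esub> x \<in> K \<inter> H" if "x \<in> K \<inter> H" "k \<in> K \<inter> H" for x k
  proof -
    have k: "inv\<^bsub>?H\<^esub> k \<in> H" "inv\<^bsub>?H\<^esub> k \<otimes>\<^bsub>G\<^esub> k = \<one>\<^bsub>G\<^esub>"
      using H.inv_closed[of k] H.l_inv[of k] that by auto
    \<comment> \<open>Uniqueness of inverses identifies those of the group on \<open>H\<close> with
      those of \<open>G\<close>, so that the subgroup property of \<open>K\<close> in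
      \<open>G\<close> applies.\<close>
    then have "inv\<^bsub>?H\<^esub> k = inv\<^bsub>G\<^esub> k"
      using H that by (intro inv_equality[symmetric]) auto
    then have "inv\<^bsub>?H\<^esub> k \<otimes>\<^bsub>G\<^esub> x \<in> K"
      using K that by (auto intro: subgroup.m_closed subgroup.m_inv_closed)
    moreover have "inv\<^bsub>?H\<^esub> k \<otimes>\<^bsub>?H\<^esub> x \<in> H"
      using H.m_closed[of "inv\<^bsub>?H\<^esub> k" x] k(1) that by simp
    ultimately show ?thesis by simp
  qed
  ultimately show ?thesis
    using W(2,3) by (intro lie_group_discreteI[OF lie]) auto
qed

lemma funpow_hom: "f \<in> hom G G \<Longrightarrow> (f ^^ n) \<in> hom G G"
proof (induction n)
  case (Suc n)
  then show ?case using hom_compose[of "f ^^ n" G G f G] by (simp only: funpow.simps)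
qed (auto simp: hom_def)

text \<open>The kernels of the iterates form an increasing chain, so any two elements lie in a
  common one.\<close>

lemma subgroup_iterated_kernel:
  assumes "group G" and f: "f \<in> hom G G"
  shows "subgroup (iterated_kernel G f) G"
proof -
  interpret group G by fact
  have hom: "group_hom G G (f ^^ n)" for n
    using funpow_hom[OF f] by unfold_locales
  have sub: "subgroup (kernel G G (f ^^ n)) G" for n
    using group_hom.subgroup_kernel[OF hom] .
  have mono: "x \<in> kernel G G (f ^^ (k + n))" if x: "x \<in> kernel G G (f ^^ n)" for x n k
    using x group_hom.hom_one[OF hom, of k] by (simp add: kernel_def funpow_add)
  show ?thesis
  proof (rule subgroupI)
    show "iterated_kernel G f \<subseteq> carrier G" by (auto simp: iterated_kernel_def kernel_def)
    show "iterated_kernel G f \<noteq> {}"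
      using subgroup.one_closed[OF sub] by (auto simp: iterated_kernel_def)
    show "inv\<^bsub>G\<^esub> x \<in> iterated_kernel G f" if "x \<in> iterated_kernel G f" for x
      using that subgroup.m_inv_closed[OF sub] by (auto simp: iterated_kernel_def)
    show "x \<otimes>\<^bsub>G\<^esub> y \<in> iterated_kernel G f"
      if "x \<in> iterated_kernel G f" "y \<in> iterated_kernel G f" for x y
    proof -
      obtain i j where "x \<in> kernel G G (f ^^ i)" "y \<in> kernel G G (f ^^ j)"
        using \<open>x \<in> _\<close> \<open>y \<in> _\<close> by (auto simp: iterated_kernel_def)
      then have "x \<in> kernel G G (f ^^ (i + j))" "y \<in> kernel G G (f ^^ (i + j))"
        using mono[of x i j] mono[of y j i] by (simp_all add: add.commute)
      then show ?thesis
        using subgroup.m_closed[OF sub] by (auto simp: iterated_kernel_def)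
    qed
  qed
qed

theorem proposition1p7:
  fixes G :: "'g monoid"
    and M :: "('g, 'k::td_local_field) analytic_structure"
    and \<alpha> :: "'g \<Rightarrow> 'g"
    and av :: "'k \<Rightarrow> real" and avc :: "'k alg_closure \<Rightarrow> real"
    and Es :: "real \<Rightarrow> (('g, 'k) chart \<times> nat \<Rightarrow> 'k) set"
    and lev_star par_minus_star con_minus_star :: "('g, 'k) analytic_structure"
  assumes av: "absolute_value av" "induces_topology av"
    and avc: "absolute_value avc" "\<And>x. avc (to_ac x) = av x"
    and G: "lie_group G M"
    and \<alpha>: "\<alpha> \<in> hom G G" "analytic_map M M \<alpha>"
    and Es: "characteristic_subspaces avc (tangent_space M \<one>\<^bsub>G\<^esub>)
           (tangent_map M M \<alpha> \<one>\<^bsub>G\<^esub>) Es"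
    and lev_star: "lie_structure_with_open_subset G M (lev G (mtop M) \<alpha>)
           (centre_manifold G M \<alpha> Es) lev_star"
    and par_minus_star: "lie_structure_with_open_subset G M (par_minus G (mtop M) \<alpha>)
           (local_centre_unstable_manifold G M \<alpha> Es) par_minus_star"
    and con_minus_star: "lie_structure_with_open_subset G M (con_minus G (mtop M) \<alpha>)
           (local_unstable_manifold G M \<alpha>
             (characteristic_values avc (tangent_space M \<one>\<^bsub>G\<^esub>) (tangent_map M M \<alpha> \<one>\<^bsub>G\<^esub>)) Es) con_minus_star"
  shows "subtopology (mtop lev_star) (iterated_kernel G \<alpha> \<inter> lev G (mtop M) \<alpha>)
           = discrete_topology (iterated_kernel G \<alpha> \<inter> lev G (mtop M) \<alpha>) \<and>
         subtopology (mtop par_minus_star) (kernel G G \<alpha> \<inter> par_minus G (mtop M) \<alpha>)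
           = discrete_topology (kernel G G \<alpha> \<inter> par_minus G (mtop M) \<alpha>) \<and>
         subtopology (mtop con_minus_star) (kernel G G \<alpha> \<inter> con_minus G (mtop M) \<alpha>)
           = discrete_topology (kernel G G \<alpha> \<inter> con_minus G (mtop M) \<alpha>)"
proof -
  have group: "group G" and M: "analytic_manifold M" using G by (auto simp: lie_group_def)
  have one: "\<alpha> \<one>\<^bsub>G\<^esub> = \<one>\<^bsub>G\<^esub>" using hom_one[OF \<alpha>(1) group group] .
  have "avc (of_nat n) \<le> 1" for n
    using td_local_field_of_nat_le_1[OF av, of n] avc(2)[of "of_nat n"] by simp
  then have avc_ultra: "ultrametric_value avc"
    using avc(1) by (intro ultrametric_value.intro absolute_value_ultrametric)
  have adapted: "\<exists>c. adapted_endo av M d N \<alpha> \<one>\<^bsub>G\<^esub> c"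
    if N: "submanifold M d N" "\<one>\<^bsub>G\<^esub> \<in> N" for d N
  proof -
    obtain c where "c \<in> adapted_charts M d N" "\<one>\<^bsub>G\<^esub> \<in> fst c"
      using N unfolding submanifold_def by blast
    then show ?thesis
      using local_valueI[OF av] M N \<alpha>(2) one
      by (intro exI[of _ c]) (simp add: adapted_endo_def adapted_endo_axioms_def)
  qed
  have ker: "subgroup (kernel G G \<alpha>) G"
    by (rule group_hom.subgroup_kernel) (simp add: group_hom_def group_hom_axioms_def group \<alpha>(1))
  have isolated: "\<exists>W. openin (subtopology (mtop M) N) W \<and> \<one>\<^bsub>G\<^esub> \<in> W \<and> W \<inter> kernel G G \<alpha> \<subseteq> {\<one>\<^bsub>G\<^esub>}"
    if N: "submanifold M d N" "\<one>\<^bsub>G\<^esub> \<in> N"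
      and S: "sub_tangent_space M d N \<one>\<^bsub>G\<^esub> = sum_of_subspaces I Es" "I \<subseteq> {0<..}" for d N I
  proof -
    obtain c where "adapted_endo av M d N \<alpha> \<one>\<^bsub>G\<^esub> c" using adapted[OF N] by blast
    from adapted_endo.kernel_isolated[OF this avc_ultra avc(2) Es equalityD1[OF S(1)] S(2)]
    show ?thesis by (auto simp: kernel_def)
  qed
  have "subtopology (mtop lev_star) (iterated_kernel G \<alpha> \<inter> lev G (mtop M) \<alpha>)
      = discrete_topology (iterated_kernel G \<alpha> \<inter> lev G (mtop M) \<alpha>)"
  proof (rule lie_structure_discreteI[OF group _ subgroup_iterated_kernel[OF group \<alpha>(1)] lev_star])
    show "lev G (mtop M) \<alpha> \<subseteq> carrier G" by (auto simp: lev_def par_def)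
    fix d N assume "submanifold M d N" "centre_manifold G M \<alpha> Es d N"
    then have N: "submanifold M d N" "\<one>\<^bsub>G\<^esub> \<in> N" "\<alpha> ` N \<subseteq> N"
      and S: "sub_tangent_space M d N \<one>\<^bsub>G\<^esub> = Es 1" by (auto simp: centre_manifold_def)
    have S': "sub_tangent_space M d N \<one>\<^bsub>G\<^esub> \<subseteq> sum_of_subspaces {1} Es"
      unfolding S sum_of_subspaces_def using fun_space.span_superset by auto
    obtain c where "adapted_endo av M d N \<alpha> \<one>\<^bsub>G\<^esub> c" using adapted[OF N(1,2)] by blast
    from adapted_endo.iterated_kernel_isolated[OF this avc_ultra avc(2) Es S' refl N(3)]
    show "\<exists>W. openin (subtopology (mtop M) N) W \<and> \<one>\<^bsub>G\<^esub> \<in> W \<and> W \<inter> iterated_kernel G \<alpha> \<subseteq> {\<one>\<^bsub>G\<^esub>}"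
      by (auto simp: iterated_kernel_def kernel_def)
  qed
  moreover have "subtopology (mtop par_minus_star) (kernel G G \<alpha> \<inter> par_minus G (mtop M) \<alpha>)
      = discrete_topology (kernel G G \<alpha> \<inter> par_minus G (mtop M) \<alpha>)"
  proof (rule lie_structure_discreteI[OF group _ ker par_minus_star])
    show "par_minus G (mtop M) \<alpha> \<subseteq> carrier G" by (auto simp: par_minus_def)
    fix d N assume "submanifold M d N" "local_centre_unstable_manifold G M \<alpha> Es d N"
    then show "\<exists>W. openin (subtopology (mtop M) N) W \<and> \<one>\<^bsub>G\<^esub> \<in> W \<and> W \<inter> kernel G G \<alpha> \<subseteq> {\<one>\<^bsub>G\<^esub>}"
      unfolding local_centre_unstable_manifold_def
      by (elim conjE) (rule isolated[where I = "{1..}"], auto)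
  qed
  moreover have "subtopology (mtop con_minus_star) (kernel G G \<alpha> \<inter> con_minus G (mtop M) \<alpha>)
      = discrete_topology (kernel G G \<alpha> \<inter> con_minus G (mtop M) \<alpha>)"
  proof (rule lie_structure_discreteI[OF group _ ker con_minus_star])
    show "con_minus G (mtop M) \<alpha> \<subseteq> carrier G" by (auto simp: con_minus_def)
    fix d N assume "submanifold M d N" and unstable: "local_unstable_manifold G M \<alpha>
      (characteristic_values avc (tangent_space M \<one>\<^bsub>G\<^esub>) (tangent_map M M \<alpha> \<one>\<^bsub>G\<^esub>)) Es d N"
    then obtain b where "b \<ge> 1" "\<one>\<^bsub>G\<^esub> \<in> N"
      "sub_tangent_space M d N \<one>\<^bsub>G\<^esub> = sum_of_subspaces {b<..} Es"
      unfolding local_unstable_manifold_def by blast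
    \<comment> \<open>From \<open>b \<ge> 1\<close> every index above \<open>b\<close> is positive,
      so zero is excluded as an eigenvalue.\<close>
    then show "\<exists>W. openin (subtopology (mtop M) N) W \<and> \<one>\<^bsub>G\<^esub> \<in> W \<and> W \<inter> kernel G G \<alpha> \<subseteq> {\<one>\<^bsub>G\<^esub>}"
      using \<open>submanifold M d N\<close> by (intro isolated[where I = "{b<..}"]) auto
  qed
  ultimately show ?thesis by blast
qed

end
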